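(* Consider the axisymmetric hydrostatic Euler equations (AHEE) in the physical domain $\mathbb{R}\times(0,1)=\{(x,r);\ x\in\mathbb{R},\ 0<r<1\}$. Let the initial datum $u^x_0=u^x_0(x,r)$ have the following property: there exist a fixed position $\hat x\in\mathbb{R}$ and a constant $\widehat{u^x}\in\mathbb{R}$ such that (1) $u^x_0(\hat x,r)=\widehat{u^x}$ for all $r\in[0,1]$; (2) either $\partial_xL_ru^x_0(\hat x,0)=0$ or $\partial_xL_ru^x_0(\hat x,1)=0$; (3) $\partial_xL_r^2u^x_0(\hat x,r)<0$ for all $r\in(0,1)$, where $L_r:=\frac1r\partial_r$. Then there exists a finite time $T>0$ such that if a solution $(\vec u,p)=(u^xe_x+u^re_r,p)$ to (AHEE) with initial datum $u^x_0$ remains smooth in the time interval $[0,T)$, then $$\lim_{t\to T^-}\max\left\{\|u^x(t)\|_{L^\infty},\ \|\partial_xu^x(t)\|_{L^\infty},\ \|\partial_xp(t)\|_{L^\infty}\right\}=\infty.$$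
   Context: (AHEE) on the infinite tube: for $(t,x,r)\in(0,T)\times\mathbb{R}\times(0,1)$, with unknowns $u^x(t,x,r)$, $u^r(t,x,r)$ and $p=p(t,x)$ (independent of $r$), $$\partial_tu^x+u^x\partial_xu^x+u^r\partial_ru^x=-\partial_xp,\quad \partial_xu^x+\tfrac1r\partial_r(ru^r)=0,\quad u^r|_{r=1}=0,\quad u^x|_{t=0}=u^x_0.$$ Here $e_x$, $e_r$ are the unit vectors in the $x$ and radial directions. Smoothness means that $u^xe_x+u^re_r$ is smooth as a three-dimensional axisymmetric vector field ($r=\sqrt{y^2+z^2}\le1$) including at the axis $r=0$ and the boundary; in particular $u^x$, $ru^r$ and all their derivatives with respect to $t$, $x$ and $L_r$ extend continuously to $r\in[0,1]$, and $ru^r|_{r=0}=0$. Values at $r=0$ of $L_ru^x_0$ are understood as these continuous extensions. The $L^\infty$ norms are over $\mathbb{R}\times(0,1)$ (over $\mathbb{R}$ for $\partial_xp$). *)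

theory Defs
  imports "HOL-Analysis.Analysis" "HOL-Probability.Essential_Supremum"
begin

text \<open>Functions of \<open>(x, r)\<close> and of \<open>(t, x, r)\<close> are curried. Only their values for
  \<open>r \<in> [0, 1]\<close> (and \<open>t \<in> [0, T)\<close>) play a role below.\<close>

subsection \<open>Smoothness up to the boundary\<close>

text \<open>The sets used below have nonempty interior and are convex, so the derivative relative
  to \<open>S\<close> is unique at every point of \<open>S\<close>, and \<open>smooth_on\<close> means that all partial
  derivatives in the interior extend continuously to \<open>S\<close>.\<close>

fun Ck_on ::
  "nat \<Rightarrow> 'a::real_normed_vector set \<Rightarrow> ('a \<Rightarrow> 'b::real_normed_vector) \<Rightarrow> bool" where
  "Ck_on 0 S f \<longleftrightarrow> continuous_on S f"
| "Ck_on (Suc k) S f \<longleftrightarrow>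
     (\<exists>f'. (\<forall>a\<in>S. (f has_derivative f' a) (at a within S)) \<and> (\<forall>v. Ck_on k S (\<lambda>a. f' a v)))"

definition smooth_on ::
  "'a::real_normed_vector set \<Rightarrow> ('a \<Rightarrow> 'b::real_normed_vector) \<Rightarrow> bool" where
  "smooth_on S f \<longleftrightarrow> (\<forall>k. Ck_on k S f)"

text \<open>The field \<open>u\<^sup>x e\<^sub>x + u\<^sup>r e\<^sub>r\<close> in Cartesian coordinates, with
  \<open>e\<^sub>r = (0, y/r, z/r)\<close>. On the axis the division convention makes the radial part \<open>0\<close>, the
  only value there that a continuous axisymmetric field can take.\<close>

definition axisym_field ::
  "(real \<Rightarrow> real \<Rightarrow> real \<Rightarrow> real) \<Rightarrow> (real \<Rightarrow> real \<Rightarrow> real \<Rightarrow> real) \<Rightarrow>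
   real \<times> real \<times> real \<times> real \<Rightarrow> real \<times> real \<times> real" where
  "axisym_field ux ur = (\<lambda>(t, x, y, z).
     let r = sqrt (y\<^sup>2 + z\<^sup>2) in (ux t x r, ur t x r * (y / r), ur t x r * (z / r)))"

definition smooth_axisym_field ::
  "real \<Rightarrow> (real \<Rightarrow> real \<Rightarrow> real \<Rightarrow> real) \<Rightarrow> (real \<Rightarrow> real \<Rightarrow> real \<Rightarrow> real) \<Rightarrow> bool" where
  "smooth_axisym_field T ux ur \<longleftrightarrow>
     smooth_on {(t, x, y, z). 0 \<le> t \<and> t < T \<and> y\<^sup>2 + z\<^sup>2 \<le> 1} (axisym_field ux ur)"

definition smooth_axisym_datum :: "(real \<Rightarrow> real \<Rightarrow> real) \<Rightarrow> bool" where
  "smooth_axisym_datum u0 \<longleftrightarrow>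
     smooth_on {(x, y, z). y\<^sup>2 + z\<^sup>2 \<le> 1} (\<lambda>(x::real, y, z). u0 x (sqrt (y\<^sup>2 + z\<^sup>2)))"

subsection \<open>The equations\<close>

text \<open>The pressure is asked only to be differentiable in \<open>x\<close>: the momentum equation then
  makes \<open>\<partial>\<^sub>x p\<close> as regular as the velocity, while \<open>p\<close> itself is determined only up to an
  arbitrary function of \<open>t\<close>.\<close>

definition AHEE ::
  "real \<Rightarrow> (real \<Rightarrow> real \<Rightarrow> real) \<Rightarrow>
   (real \<Rightarrow> real \<Rightarrow> real \<Rightarrow> real) \<Rightarrow> (real \<Rightarrow> real \<Rightarrow> real \<Rightarrow> real) \<Rightarrow> (real \<Rightarrow> real \<Rightarrow> real) \<Rightarrow> bool" where
  "AHEE T u0 ux ur p \<longleftrightarrow>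
     (\<forall>t\<in>{0<..<T}. \<forall>x. p t differentiable (at x)) \<and>
     (\<forall>t\<in>{0<..<T}. \<forall>x. \<forall>r\<in>{0<..<1}.
        deriv (\<lambda>s. ux s x r) t + ux t x r * deriv (\<lambda>y. ux t y r) x
          + ur t x r * deriv (\<lambda>s. ux t x s) r = - deriv (p t) x) \<and>
     (\<forall>t\<in>{0<..<T}. \<forall>x. \<forall>r\<in>{0<..<1}.
        deriv (\<lambda>y. ux t y r) x + 1 / r * deriv (\<lambda>s. s * ur t x s) r = 0) \<and>
     (\<forall>t\<in>{0<..<T}. \<forall>x. ur t x 1 = 0) \<and>
     (\<forall>x. \<forall>r\<in>{0..1}. ux 0 x r = u0 x r)"

definition smooth_AHEE_solution ::
  "real \<Rightarrow> (real \<Rightarrow> real \<Rightarrow> real) \<Rightarrow>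
   (real \<Rightarrow> real \<Rightarrow> real \<Rightarrow> real) \<Rightarrow> (real \<Rightarrow> real \<Rightarrow> real \<Rightarrow> real) \<Rightarrow> (real \<Rightarrow> real \<Rightarrow> real) \<Rightarrow> bool" where
  "smooth_AHEE_solution T u0 ux ur p \<longleftrightarrow> smooth_axisym_field T ux ur \<and> AHEE T u0 ux ur p"

subsection \<open>Differential operators and norms\<close>

definition dx :: "(real \<Rightarrow> real \<Rightarrow> real) \<Rightarrow> real \<Rightarrow> real \<Rightarrow> real" where
  "dx f x r = deriv (\<lambda>y. f y r) x"

text \<open>\<open>L\<^sub>r = (1/r) \<partial>\<^sub>r\<close> on \<open>(0, 1]\<close> (one-sided derivative at \<open>r = 1\<close>), continuously extended
  to \<open>r = 0\<close>.\<close>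

definition Lr :: "(real \<Rightarrow> real \<Rightarrow> real) \<Rightarrow> real \<Rightarrow> real \<Rightarrow> real" where
  "Lr f x r =
     (if r = 0 then Lim (at_right 0) (\<lambda>s. 1 / s * vector_derivative (f x) (at s within {0..1}))
      else 1 / r * vector_derivative (f x) (at r within {0..1}))"

definition Linf_norm :: "'a::euclidean_space set \<Rightarrow> ('a \<Rightarrow> real) \<Rightarrow> ereal" where
  "Linf_norm A f = esssup (lebesgue_on A) (\<lambda>a. ereal \<bar>f a\<bar>)"

abbreviation tube :: "(real \<times> real) set" where
  "tube \<equiv> UNIV \<times> {0<..<1}"

end

theory Submission
  imports Defs
begin

text \<open>In the variable \<open>s = r\<^sup>2/2\<close> the system is the two-dimensional hydrostatic Euler system. The mean of
  \<open>u\<^sup>x\<close> over a cross-section depends on \<open>t\<close> only; let \<open>X\<close> move with this mean velocity from \<open>xhat\<close>. A maximum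
  principle for \<open>u\<^sup>x\<close> minus its mean shows that \<open>u\<^sup>x\<close> stays independent of \<open>r\<close> on the line \<open>x = X t\<close>, so that
  \<open>a = \<partial>\<^sub>x u\<^sup>x\<close> solves a closed equation on this line:
  \<open>a\<^sub>t + a\<^sup>2 + u\<^sup>r a\<^sub>r = 4 \<integral> r a\<^sup>2\<close>. By further maximum principles \<open>a\<close> stays monotone in \<open>r\<close> and concave in \<open>s\<close>,
  and it has mean zero; comparison with an affine function of \<open>s\<close> bounds the right-hand side by two thirds of
  \<open>a\<^sup>2\<close> at the endpoint where \<open>a\<close> is smallest. There \<open>- a\<close> satisfies \<open>y' \<ge> y\<^sup>2/3\<close>, which limits the
  lifespan of every smooth solution by a constant depending on the datum. For the theorem it
  suffices to take \<open>T\<close> larger than this constant, since then no solution is smooth on \<open>[0, T)\<close>.\<close>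

section \<open>Analytic tools\<close>

text \<open>The weighted function \<open>exp (- (K + 1) * t) * h t r\<close> attains its maximum
  over the compact rectangle. If that maximum were positive, it would lie at a positive time and the
  weighted function would be strictly decreasing in time there, so slightly earlier values would be
  larger. The differential inequality is therefore demanded only at positive spatial maxima, where
  transport terms disappear.\<close>

lemma max_principle:
  fixes h :: "real \<Rightarrow> real \<Rightarrow> real"
  assumes cont: "continuous_on ({0..\<tau>} \<times> {0..1}) (\<lambda>(t, r). h t r)"
    and init: "\<And>r. r \<in> {0..1} \<Longrightarrow> h 0 r \<le> 0"
    and step: "\<And>t r. \<lbrakk>0 < t; t \<le> \<tau>; r \<in> {0..1}; 0 < h t r; \<And>r'. r' \<in> {0..1} \<Longrightarrow> h t r' \<le> h t r\<rbrakk>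
      \<Longrightarrow> \<exists>D. ((\<lambda>t. h t r) has_real_derivative D) (at t) \<and> D \<le> K * h t r"
    and t: "t \<in> {0..\<tau>}" and r: "r \<in> {0..1}"
  shows "h t r \<le> 0"
proof (rule ccontr)
  assume "\<not> h t r \<le> 0"
  then have pos: "0 < h t r" by simp
  \<comment> \<open>The rate \<open>K + 1\<close> instead of \<open>K\<close> makes the time
    derivative at a positive maximum strictly negative.\<close>
  define \<Phi> where "\<Phi> = (\<lambda>(t, r). exp (- (K + 1) * t) * h t r)"
  have "continuous_on ({0..\<tau>} \<times> {0..1}) (\<lambda>z. exp (- (K + 1) * fst z) * (\<lambda>(t, r). h t r) z)"
    by (intro continuous_intros cont)
  then have c: "continuous_on ({0..\<tau>} \<times> {0..1}) \<Phi>"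
    by (simp add: \<Phi>_def case_prod_unfold)
  have cpt: "compact ({0..\<tau>} \<times> {0..1::real})" by (intro compact_Times) auto
  have "(t, r) \<in> {0..\<tau>} \<times> {0..1}" using t r by auto
  then obtain z where z: "z \<in> {0..\<tau>} \<times> {0..1}" "\<And>y. y \<in> {0..\<tau>} \<times> {0..1} \<Longrightarrow> \<Phi> y \<le> \<Phi> z"
    using continuous_attains_sup[OF cpt _ c] by blast
  obtain t0 r0 where z0: "z = (t0, r0)" by (cases z)
  have in0: "t0 \<in> {0..\<tau>}" "r0 \<in> {0..1}" using z(1) z0 by auto
  have mx: "exp (- (K + 1) * s) * h s q \<le> exp (- (K + 1) * t0) * h t0 r0"
    if "s \<in> {0..\<tau>}" "q \<in> {0..1}" for s q
    using z(2)[of "(s, q)"] that by (auto simp: \<Phi>_def z0)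
  have "0 < exp (- (K + 1) * t) * h t r" using pos by simp
  then have "0 < exp (- (K + 1) * t0) * h t0 r0" using mx[OF t r] by linarith
  then have p0: "0 < h t0 r0" by (simp add: zero_less_mult_iff)
  have "t0 \<noteq> 0" using init[OF in0(2)] p0 by force
  then have t0: "0 < t0" "t0 \<le> \<tau>" using in0 by auto
  have "h t0 r' \<le> h t0 r0" if "r' \<in> {0..1}" for r'
    using mx[OF in0(1) that] by simp
  then obtain D where D: "((\<lambda>t. h t r0) has_real_derivative D) (at t0)" "D \<le> K * h t0 r0"
    using step[OF t0 in0(2) p0] by blast
  have der: "((\<lambda>t. exp (- (K + 1) * t) * h t r0) has_real_derivative
      exp (- (K + 1) * t0) * (D - (K + 1) * h t0 r0)) (at t0)"
    by (auto intro!: derivative_eq_intros D(1) simp: algebra_simps)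
  have "D - (K + 1) * h t0 r0 < 0" using D(2) p0 by (simp add: algebra_simps)
  then have "exp (- (K + 1) * t0) * (D - (K + 1) * h t0 r0) < 0"
    by (simp add: mult_pos_neg)
  from DERIV_neg_dec_left[OF der this] obtain d where d: "d > 0"
    "\<And>k. k > 0 \<Longrightarrow> k < d \<Longrightarrow> exp (- (K + 1) * t0) * h t0 r0 < exp (- (K + 1) * (t0 - k)) * h (t0 - k) r0"
    by blast
  \<comment> \<open>A step back in time, short enough for the strict decrease and not leaving the
    rectangle.\<close>
  define k where "k = min (d / 2) t0"
  have "k > 0" "k < d" "t0 - k \<in> {0..\<tau>}" using d t0 by (auto simp: k_def)
  then show False using d(2)[of k] mx[of "t0 - k" r0] in0 by force
qed

text \<open>An interior maximum makes \<open>f'\<close> vanish; at the axis and the wall it is the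
  transport speed \<open>c\<close> that vanishes. Hence the maximum principle needs no boundary
  condition on the transported quantity.\<close>

lemma critical_transport_term:
  fixes f :: "real \<Rightarrow> real"
  assumes "(f has_real_derivative f') (at r within {0..1})" "r \<in> {0..1}"
    and "\<And>r'. r' \<in> {0..1} \<Longrightarrow> f r' \<le> f r" and "r = 0 \<or> r = 1 \<Longrightarrow> c = 0"
  shows "c * f' = 0"
proof (cases "r = 0 \<or> r = 1")
  case False
  then have r: "0 < r" "r < 1" using assms(2) by auto
  then have "at r within {0..1} = at r" by (intro at_within_interior) auto
  then have d: "(f has_real_derivative f') (at r)" using assms(1) by simp
  have "f' = 0"
  proof (rule DERIV_local_max[OF d, of "min r (1 - r)"])
    show "\<forall>y. \<bar>r - y\<bar> < min r (1 - r) \<longrightarrow> f y \<le> f r"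
      using assms(3) by (auto simp: abs_less_iff)
  qed (use r in auto)
  then show ?thesis by simp
qed (use assms(4) in auto)

text \<open>While \<open>y\<close> is positive, \<open>1 / y t + k * t\<close> is nonincreasing. At
  time \<open>1 / (k * y 0)\<close> this would force \<open>1 / y\<close> to be at most 0, although
  \<open>y\<close> is still positive.\<close>

lemma riccati_lifespan:
  fixes y :: "real \<Rightarrow> real"
  assumes cont: "continuous_on {0..<T} y"
    and der: "\<And>t. 0 < t \<Longrightarrow> t < T \<Longrightarrow> \<exists>D. (y has_real_derivative D) (at t) \<and> k * (y t)\<^sup>2 \<le> D"
    and k: "k > 0" and y0: "0 < y 0"
  shows "T \<le> 1 / (k * y 0)"
proof (rule ccontr)
  define s where "s = 1 / (k * y 0)"
  assume "\<not> T \<le> 1 / (k * y 0)"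
  then have sT: "s < T" by (simp add: s_def)
  have s0: "0 < s" using k y0 by (simp add: s_def)
  have cs: "continuous_on {0..t} y" if "t \<le> s" for t
    by (rule continuous_on_subset[OF cont]) (use sT that in auto)
  have pos: "0 < y t" if t: "t \<in> {0..s}" for t
  proof -
    have "y 0 \<le> y t"
    proof (rule DERIV_nonneg_imp_increasing_open[where f = y])
      show "\<exists>D. (y has_real_derivative D) (at u) \<and> 0 \<le> D" if u: "0 < u" "u < t" for u
      proof -
        have "u < T" using u t sT by auto
        then obtain D where "(y has_real_derivative D) (at u)" "k * (y u)\<^sup>2 \<le> D"
          using der[of u] u by blast
        moreover have "0 \<le> k * (y u)\<^sup>2" using k by simp
        ultimately show ?thesis using order_trans by blast
      qed
    qed (use t cs in auto)
    then show ?thesis using y0 by simp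
  qed
  have "1 / y 0 - k * 0 \<ge> 1 / y s + k * s"
  proof -
    have "- (1 / y 0 + k * 0) \<le> - (1 / y s + k * s)"
    proof (rule DERIV_nonneg_imp_increasing_open[where f = "\<lambda>t. - (1 / y t + k * t)"])
      show "\<exists>E. ((\<lambda>t. - (1 / y t + k * t)) has_real_derivative E) (at u) \<and> 0 \<le> E"
        if u: "0 < u" "u < s" for u
      proof -
        obtain D where D: "(y has_real_derivative D) (at u)" "k * (y u)\<^sup>2 \<le> D"
          using der[of u] u sT by auto
        have p: "0 < y u" using pos[of u] u by auto
        have "((\<lambda>t. - (1 / y t + k * t)) has_real_derivative D / (y u)\<^sup>2 - k) (at u)"
          using p by (auto intro!: derivative_eq_intros D(1) simp: power2_eq_square)
        moreover have "0 \<le> D / (y u)\<^sup>2 - k" using D(2) p by (simp add: field_simps)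
        ultimately show ?thesis by blast
      qed
      show "continuous_on {0..s} (\<lambda>t. - (1 / y t + k * t))"
        using pos by (intro continuous_intros cs) force+
    qed (use s0 in auto)
    then show ?thesis by simp
  qed
  moreover have "k * s = 1 / y 0" using k y0 by (simp add: s_def)
  moreover have "1 / y s > 0" using pos[of s] s0 by simp
  ultimately show False by simp
qed

lemma has_field_derivative_transform:
  assumes "x \<in> S" "\<And>y. y \<in> S \<Longrightarrow> g y = f y" "(f has_field_derivative f') (at x within S)"
  shows "(g has_field_derivative f') (at x within S)"
  using has_derivative_transform[OF assms(1,2)] assms(3) by (simp add: has_field_derivative_def)

text \<open>Differentiating \<open>f t r = f t1 r + \<integral> G\<close> under the integral gives the existence of the mixed
  derivative, not only its symmetry.\<close>

lemma interchange_derivatives: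
  fixes f q G Gr :: "real \<Rightarrow> real \<Rightarrow> real"
  assumes ft: "\<And>t r. t \<in> {a<..<b} \<Longrightarrow> r \<in> {c..d} \<Longrightarrow> ((\<lambda>t. f t r) has_real_derivative G t r) (at t)"
    and fr: "\<And>t r. t \<in> {a<..<b} \<Longrightarrow> r \<in> {c..d} \<Longrightarrow> ((\<lambda>r. f t r) has_real_derivative q t r) (at r within {c..d})"
    and Gr: "\<And>t r. t \<in> {a<..<b} \<Longrightarrow> r \<in> {c..d} \<Longrightarrow> ((\<lambda>r. G t r) has_real_derivative Gr t r) (at r within {c..d})"
    and cGr: "continuous_on ({a<..<b} \<times> {c..d}) (\<lambda>(t, r). Gr t r)"
    and cd: "c < d" and t: "t \<in> {a<..<b}" and r: "r \<in> {c..d}"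
  shows "((\<lambda>t. q t r) has_real_derivative Gr t r) (at t)"
proof -
  \<comment> \<open>A compact interval around \<open>t\<close> inside the open one, on which the
    integrals exist.\<close>
  define t1 where "t1 = (a + t) / 2"
  define t2 where "t2 = (t + b) / 2"
  have t12: "a < t1" "t1 < t" "t < t2" "t2 < b" using t by (auto simp: t1_def t2_def)
  have ftc: "((\<lambda>\<tau>. G \<tau> y) has_integral f s y - f t1 y) {t1..s}"
    if "s \<in> {t1..t2}" "y \<in> {c..d}" for s y
  proof (rule fundamental_theorem_of_calculus)
    show "((\<lambda>t. f t y) has_vector_derivative G x y) (at x within {t1..s})" if "x \<in> {t1..s}" for x
      using ft[of x y] that \<open>s \<in> {t1..t2}\<close> \<open>y \<in> {c..d}\<close> t12
      by (auto simp: has_real_derivative_iff_has_vector_derivative[symmetric] intro: DERIV_subset)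
  qed (use that in auto)
  have key: "q s r = q t1 r + integral {t1..s} (\<lambda>\<tau>. Gr \<tau> r)" if s: "s \<in> {t1..t2}" for s
  proof -
    have "((\<lambda>y. integral (cbox t1 s) (\<lambda>\<tau>. G \<tau> y)) has_field_derivative
        integral (cbox t1 s) (\<lambda>\<tau>. Gr \<tau> r)) (at r within {c..d})"
    proof (rule leibniz_rule_field_derivative[where f = "\<lambda>y \<tau>. G \<tau> y" and fx = "\<lambda>y \<tau>. Gr \<tau> y"])
      show "(\<lambda>\<tau>. G \<tau> x) integrable_on cbox t1 s" if "x \<in> {c..d}" for x
        using ftc[OF s that] by (auto simp: has_integral_integrable)
      have "continuous_on ({c..d} \<times> cbox t1 s) (\<lambda>z. (\<lambda>(t, r). Gr t r) (snd z, fst z))"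
        by (rule continuous_on_compose2[OF cGr]) (use s t12 in \<open>auto intro!: continuous_intros\<close>)
      then show "continuous_on ({c..d} \<times> cbox t1 s) (\<lambda>(y, \<tau>). Gr \<tau> y)"
        by (simp add: case_prod_unfold)
      show "((\<lambda>y. G \<tau> y) has_real_derivative Gr \<tau> x) (at x within {c..d})"
        if "x \<in> {c..d}" "\<tau> \<in> cbox t1 s" for x \<tau>
        by (rule Gr) (use that s t12 in auto)
    qed (use r in auto)
    then have "((\<lambda>y. f t1 y + integral {t1..s} (\<lambda>\<tau>. G \<tau> y)) has_real_derivative
        q t1 r + integral {t1..s} (\<lambda>\<tau>. Gr \<tau> r)) (at r within {c..d})"
      by (intro DERIV_add fr) (use t12 r in \<open>auto\<close>)
    moreover have "f t1 y + integral {t1..s} (\<lambda>\<tau>. G \<tau> y) = f s y" if "y \<in> {c..d}" for y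
      using integral_unique[OF ftc[OF s that]] by linarith
    ultimately have "((\<lambda>y. f s y) has_real_derivative
        q t1 r + integral {t1..s} (\<lambda>\<tau>. Gr \<tau> r)) (at r within {c..d})"
      using has_field_derivative_transform[OF r, where f = "\<lambda>y. f t1 y + integral {t1..s} (\<lambda>\<tau>. G \<tau> y)"]
      by simp
    moreover have "((\<lambda>y. f s y) has_real_derivative q s r) (at r within {c..d})"
      using fr[of s r] s t12 r by auto
    ultimately show ?thesis
      using vector_derivative_unique_within_closed_interval[OF cd, of r "\<lambda>y. f s y"] r
      by (simp add: has_real_derivative_iff_has_vector_derivative)
  qed
  have "((\<lambda>s. integral {t1..s} (\<lambda>\<tau>. Gr \<tau> r)) has_real_derivative Gr t r) (at t within {t1..t2})"
  proof (rule integral_has_real_derivative)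
    have "continuous_on {t1..t2} (\<lambda>\<tau>. (\<lambda>(t, r). Gr t r) (\<tau>, r))"
      by (rule continuous_on_compose2[OF cGr]) (use r t12 in \<open>auto intro!: continuous_intros\<close>)
    then show "continuous_on {t1..t2} (\<lambda>\<tau>. Gr \<tau> r)" by simp
  qed (use t12 in auto)
  from DERIV_add[OF DERIV_const this]
  have der: "((\<lambda>s. q t1 r + integral {t1..s} (\<lambda>\<tau>. Gr \<tau> r)) has_real_derivative Gr t r) (at t within {t1..t2})"
    by simp
  have "((\<lambda>s. q s r) has_real_derivative Gr t r) (at t within {t1..t2})"
    by (rule has_field_derivative_transform[OF _ key der]) (use t12 in auto)
  moreover have "at t within {t1..t2} = at t"
    by (rule at_within_interior) (use t12 in \<open>auto simp: interior_atLeastAtMost_real\<close>)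
  ultimately show ?thesis by simp
qed

section \<open>Calculus of functions that are smooth up to the boundary\<close>

lemma Ck_on_cong:
  assumes "Ck_on k S f" "\<And>a. a \<in> S \<Longrightarrow> f a = g a"
  shows "Ck_on k S g"
proof (cases k)
  case 0
  then show ?thesis using assms continuous_on_cong[of S S f g] by simp
next
  case (Suc n)
  then obtain f' where f': "\<And>a. a \<in> S \<Longrightarrow> (f has_derivative f' a) (at a within S)"
    "\<And>v. Ck_on n S (\<lambda>a. f' a v)"
    using assms(1) by auto
  have "(g has_derivative f' a) (at a within S)" if "a \<in> S" for a
    using has_derivative_transform[OF that _ f'(1)[OF that], of g] assms(2) by simp
  then show ?thesis using f' Suc by auto
qed

lemma Ck_on_linear_image:
  assumes L: "bounded_linear L"
  shows "Ck_on k S f \<Longrightarrow> Ck_on k S (\<lambda>a. L (f a))"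
proof (induction k arbitrary: f)
  case 0
  then show ?case using bounded_linear.continuous_on[OF L] by simp
next
  case (Suc k)
  then obtain f' where f': "\<And>a. a \<in> S \<Longrightarrow> (f has_derivative f' a) (at a within S)"
    "\<And>v. Ck_on k S (\<lambda>a. f' a v)"
    by auto
  have "((\<lambda>a. L (f a)) has_derivative (\<lambda>v. L (f' a v))) (at a within S)" if "a \<in> S" for a
    by (rule bounded_linear.has_derivative[OF L f'(1)[OF that]])
  moreover have "Ck_on k S (\<lambda>a. L (f' a v))" for v using Suc.IH f'(2) .
  ultimately show ?case
    by (auto intro!: exI[of _ "\<lambda>a v. L (f' a v)"])
qed

text \<open>The derivative of the composition in direction \<open>v\<close> is the derivative of
  \<open>f\<close> in the fixed direction \<open>L v\<close>, composed with \<open>L\<close>, so the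
  induction closes. It serves to restrict the Cartesian field to a meridian half-plane.\<close>

lemma Ck_on_compose_linear:
  assumes L: "bounded_linear L" and sub: "L ` S' \<subseteq> S"
  shows "Ck_on k S f \<Longrightarrow> Ck_on k S' (\<lambda>a. f (L a))"
proof (induction k arbitrary: f)
  case 0
  then have "continuous_on S f" by simp
  then have "continuous_on S' (\<lambda>a. f (L a))"
    using continuous_on_compose2 sub linear_continuous_on[OF L] by blast
  then show ?case by simp
next
  case (Suc k)
  then obtain f' where f': "\<And>a. a \<in> S \<Longrightarrow> (f has_derivative f' a) (at a within S)"
    "\<And>v. Ck_on k S (\<lambda>a. f' a v)"
    by auto
  have "((\<lambda>a. f (L a)) has_derivative (\<lambda>v. f' (L a) (L v))) (at a within S')" if "a \<in> S'" for a
    using has_derivative_in_compose2[OF f'(1) sub that bounded_linear_imp_has_derivative[OF L]] .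
  moreover have "Ck_on k S' (\<lambda>a. f' (L a) (L v))" for v using Suc.IH f'(2) .
  ultimately show ?case
    by (auto intro!: exI[of _ "\<lambda>a v. f' (L a) (L v)"])
qed

section \<open>Concave profiles with mean zero\<close>

lemma bounded_before:
  fixes F :: "real \<Rightarrow> real \<Rightarrow> real"
  assumes "continuous_on ({0..<T} \<times> {0..1}) (\<lambda>(t, r). F t r)" "\<tau> < T"
  obtains K where "\<And>t r. t \<in> {0..\<tau>} \<Longrightarrow> r \<in> {0..1} \<Longrightarrow> \<bar>F t r\<bar> \<le> K"
proof -
  have "compact ((\<lambda>(t, r). F t r) ` ({0..\<tau>} \<times> {0..1}))"
    by (intro compact_continuous_image continuous_on_subset[OF assms(1)] compact_Times)
      (use assms(2) in auto)
  then have "bounded ((\<lambda>(t, r). F t r) ` ({0..\<tau>} \<times> {0..1}))" by (rule compact_imp_bounded)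
  then obtain K where K: "\<forall>x\<in>(\<lambda>(t, r). F t r) ` ({0..\<tau>} \<times> {0..1}). norm x \<le> K"
    unfolding bounded_iff by blast
  have "\<bar>F t r\<bar> \<le> K" if "t \<in> {0..\<tau>}" "r \<in> {0..1}" for t r
    using K that by (force simp: image_iff)
  then show ?thesis by (rule that)
qed

text \<open>With respect to \<open>r\<^sup>2 / 2\<close> the derivative of \<open>D\<close> is
  \<open>n\<close>, so \<open>D\<close> is concave there, and a concave function is nonnegative
  between two zeros. A negative value would give, by the mean value theorem, a negative slope on its
  left and a positive slope on its right.\<close>

lemma nonneg_between_zeros:
  fixes D :: "real \<Rightarrow> real"
  assumes der: "\<And>r. r \<in> {0..1} \<Longrightarrow> (D has_real_derivative r * n r) (at r within {0..1})"
    and anti: "\<And>p s. 0 < p \<Longrightarrow> p \<le> s \<Longrightarrow> s < 1 \<Longrightarrow> n s \<le> n p"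
    and ps: "0 \<le> p" "p < s" "s \<le> 1" and zero: "D p = 0" "D s = 0" and r: "r \<in> {p..s}"
  shows "0 \<le> D r"
proof (rule ccontr)
  assume "\<not> 0 \<le> D r"
  then have neg: "D r < 0" by simp
  then have pr: "p < r" "r < s" using r zero by (auto simp: less_le)
  have at: "at z within {0..1} = at z" if "0 < z" "z < 1" for z :: real
    by (rule at_within_interior) (use that in \<open>auto simp: interior_atLeastAtMost_real\<close>)
  have cont: "continuous_on {0..1} D"
    by (rule DERIV_continuous_on) (rule der)
  have mvt: "\<exists>z. x < z \<and> z < y \<and> D y - D x = (y - x) * (z * n z)" if "p \<le> x" "x < y" "y \<le> s" for x y
  proof -
    have "continuous_on {x..y} D" by (rule continuous_on_subset[OF cont]) (use that ps in auto)
    moreover have "D differentiable (at z)" if z: "x < z" "z < y" for z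
      using der[of z] at[of z] z \<open>p \<le> x\<close> \<open>y \<le> s\<close> ps real_differentiable_def by auto
    ultimately obtain l z where z: "x < z" "z < y" "(D has_real_derivative l) (at z)" "D y - D x = (y - x) * l"
      using MVT[OF \<open>x < y\<close>] by blast
    have "(D has_real_derivative z * n z) (at z)"
      using der[of z] at[of z] z that ps by auto
    then have "l = z * n z" using z(3) DERIV_unique by blast
    then show ?thesis using z by blast
  qed
  obtain z1 where z1: "p < z1" "z1 < r" "D r - D p = (r - p) * (z1 * n z1)" using mvt[of p r] pr by auto
  obtain z2 where z2: "r < z2" "z2 < s" "D s - D r = (s - r) * (z2 * n z2)" using mvt[of r s] pr by auto
  have "(r - p) * (z1 * n z1) < 0" using z1 zero neg by simp
  then have "n z1 < 0" using pr z1 ps by (auto simp: mult_less_0_iff zero_less_mult_iff)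
  moreover have "0 < (s - r) * (z2 * n z2)" using z2 zero neg by simp
  then have "0 < n z2" using pr z2 ps z1 by (auto simp: zero_less_mult_iff)
  ultimately show False using anti[of z1 z2] z1 z2 ps by auto
qed

text \<open>In the variable \<open>s = r\<^sup>2\<close> the profile \<open>a\<close> is concave with mean zero; \<open>w\<close> is a primitive of \<open>- r a\<close>.
  The comparison function is the affine function \<open>c (1 - 2 s)\<close> that agrees with \<open>a\<close> at the endpoint
  where \<open>a\<close> is smallest.\<close>

locale profile =
  fixes a q w :: "real \<Rightarrow> real"
  assumes da: "r \<in> {0..1} \<Longrightarrow> (a has_real_derivative q r) (at r within {0..1})"
    and dw: "r \<in> {0..1} \<Longrightarrow> (w has_real_derivative - (r * a r)) (at r within {0..1})"
    and w0: "w 0 = 0" and w1: "w 1 = 0"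
begin

lemma at_inner: "0 < z \<Longrightarrow> z < 1 \<Longrightarrow> at z within {0..1} = at (z::real)"
  by (rule at_within_interior) (auto simp: interior_atLeastAtMost_real)

lemma cont_a: "continuous_on {0..1} a"
  by (rule DERIV_continuous_on) (rule da)

lemma cont_w: "continuous_on {0..1} w"
  by (rule DERIV_continuous_on) (rule dw)

text \<open>Mean zero in the form used later: the primitive \<open>w\<close> would be strictly
  decreasing, yet it vanishes at both ends.\<close>

lemma not_positive: "\<not> (\<forall>r\<in>{0<..<1}. 0 < a r)"
proof
  assume pos: "\<forall>r\<in>{0<..<1}. 0 < a r"
  have "w 1 < w 0"
  proof (rule DERIV_neg_imp_decreasing_open[where f = w])
    show "\<exists>y. (w has_real_derivative y) (at x) \<and> y < 0" if "0 < x" "x < 1" for x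
      using dw[of x] at_inner[OF that] pos that by (intro exI[of _ "- (x * a x)"]) auto
  qed (use cont_w in auto)
  then show False using w0 w1 by simp
qed

lemma decreasing:
  assumes "\<forall>r\<in>{0<..<1}. q r < 0" "0 \<le> x" "x < y" "y \<le> 1"
  shows "a y < a x"
proof (rule DERIV_neg_imp_decreasing_open[where f = a])
  show "\<exists>d. (a has_real_derivative d) (at z) \<and> d < 0" if "x < z" "z < y" for z
    using da[of z] at_inner[of z] assms that by (intro exI[of _ "q z"]) auto
qed (use assms cont_a in \<open>auto intro: continuous_on_subset\<close>)

lemma increasing:
  assumes "\<forall>r\<in>{0<..<1}. 0 < q r" "0 \<le> x" "x < y" "y \<le> 1"
  shows "a x < a y"
proof (rule DERIV_pos_imp_increasing_open[where f = a])
  show "\<exists>d. (a has_real_derivative d) (at z) \<and> 0 < d" if "x < z" "z < y" for z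
    using da[of z] at_inner[of z] assms that by (intro exI[of _ "q z"]) auto
qed (use assms cont_a in \<open>auto intro: continuous_on_subset\<close>)

lemma nonincreasing:
  assumes "\<forall>r\<in>{0..1}. q r \<le> 0" "0 \<le> x" "x \<le> y" "y \<le> 1"
  shows "a y \<le> a x"
proof (rule DERIV_nonpos_imp_decreasing_open[where f = a])
  show "\<exists>d. (a has_real_derivative d) (at z) \<and> d \<le> 0" if "x < z" "z < y" for z
    using da[of z] at_inner[of z] assms that by (intro exI[of _ "q z"]) auto
qed (use assms cont_a in \<open>auto intro: continuous_on_subset\<close>)

lemma nondecreasing:
  assumes "\<forall>r\<in>{0..1}. 0 \<le> q r" "0 \<le> x" "x \<le> y" "y \<le> 1"
  shows "a x \<le> a y"
proof (rule DERIV_nonneg_imp_increasing_open[where f = a])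
  show "\<exists>d. (a has_real_derivative d) (at z) \<and> 0 \<le> d" if "x < z" "z < y" for z
    using da[of z] at_inner[of z] assms that by (intro exI[of _ "q z"]) auto
qed (use assms cont_a in \<open>auto intro: continuous_on_subset\<close>)

text \<open>A primitive of \<open>r\<close> times the difference between \<open>a\<close> and the
  comparison function \<open>c * (1 - 2 * r\<^sup>2)\<close>. It vanishes at both ends because both
  functions have mean zero with respect to \<open>r dr\<close>.\<close>

definition W :: "real \<Rightarrow> real \<Rightarrow> real" where
  "W c r = - w r - c * (r\<^sup>2 - r ^ 4) / 2"

lemma W_ends: "W c 0 = 0" "W c 1 = 0"
  by (simp_all add: W_def w0 w1)

lemma dW: "r \<in> {0..1} \<Longrightarrow>
    (W c has_real_derivative r * (a r - c * (1 - 2 * r\<^sup>2))) (at r within {0..1})"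
  unfolding W_def
  by (auto intro!: derivative_eq_intros dw simp: field_simps power2_eq_square power3_eq_cube)

lemma cont_W: "continuous_on {0..1} (W c)"
  by (rule DERIV_continuous_on) (rule dW)

lemma dD: "r \<in> {0..1} \<Longrightarrow> ((\<lambda>r. a r - c * (1 - 2 * r\<^sup>2)) has_real_derivative q r + 4 * c * r) (at r within {0..1})"
  by (auto intro!: derivative_eq_intros da)

text \<open>The difference of \<open>r * (a r)\<^sup>2\<close> and
  \<open>r * (c * (1 - 2 * r\<^sup>2))\<^sup>2\<close> is
  \<open>(a r + c * (1 - 2 * r\<^sup>2))\<close> times the derivative of \<open>W c\<close>.
  Integration by parts turns it into minus the integral of the product assumed nonnegative, and the
  comparison function contributes exactly \<open>c\<^sup>2 / 6\<close>.\<close>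

lemma energy_bound:
  assumes sgn: "\<And>r. r \<in> {0..1} \<Longrightarrow> 0 \<le> (q r - 4 * c * r) * W c r"
  shows "integral {0..1} (\<lambda>r. r * (a r)\<^sup>2) \<le> c\<^sup>2 / 6"
proof -
  \<comment> \<open>The first term comes from the integration by parts; the cubic one is a primitive
    of \<open>c\<^sup>2 * r * (1 - 2 * r\<^sup>2)\<^sup>2\<close>.\<close>
  define \<Phi> where "\<Phi> = (\<lambda>r. (a r + c * (1 - 2 * r\<^sup>2)) * W c r - c\<^sup>2 * (1 - 2 * r\<^sup>2) ^ 3 / 12)"
  have "((\<lambda>r. r * (a r)\<^sup>2 + (q r - 4 * c * r) * W c r) has_integral (\<Phi> 1 - \<Phi> 0)) {0..1}"
  proof (rule fundamental_theorem_of_calculus)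
    show "(\<Phi> has_vector_derivative r * (a r)\<^sup>2 + (q r - 4 * c * r) * W c r) (at r within {0..1})"
      if "r \<in> {0..1}" for r
      unfolding \<Phi>_def has_real_derivative_iff_has_vector_derivative[symmetric]
      by (auto intro!: derivative_eq_intros da[OF that] dW[OF that]
          simp: field_simps power2_eq_square power3_eq_cube)
  qed auto
  moreover have "\<Phi> 1 - \<Phi> 0 = c\<^sup>2 / 6" by (simp add: \<Phi>_def W_ends)
  ultimately have I: "((\<lambda>r. r * (a r)\<^sup>2 + (q r - 4 * c * r) * W c r) has_integral (c\<^sup>2 / 6)) {0..1}" by simp
  have "(\<lambda>r. r * (a r)\<^sup>2) integrable_on {0..1}"
    by (intro integrable_continuous_real continuous_intros cont_a)
  then have "integral {0..1} (\<lambda>r. r * (a r)\<^sup>2) \<le> integral {0..1} (\<lambda>r. r * (a r)\<^sup>2 + (q r - 4 * c * r) * W c r)"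
    using I sgn by (intro integral_le) (auto simp: has_integral_integrable)
  then show ?thesis using integral_unique[OF I] by simp
qed

text \<open>At \<open>r = 0\<close> the quotient \<open>q r / r\<close> has the value 0 by
  convention; the factor \<open>r\<close> and \<open>q 0 = 0\<close> make the formula valid there
  too.\<close>

lemma slope_form:
  assumes "q 0 = 0" "r \<in> {0..1}"
  shows "((\<lambda>r. a r - c * (1 - 2 * r\<^sup>2)) has_real_derivative r * (q r / r + 4 * c)) (at r within {0..1})"
  using dD[OF assms(2), of c] assms by (cases "r = 0") (auto simp: algebra_simps)

context
  assumes q0: "q 0 = 0"
    and anti: "\<And>p s. 0 < p \<Longrightarrow> p \<le> s \<Longrightarrow> s < 1 \<Longrightarrow> q s / s \<le> q p / p"
begin

lemma anti_shift: "0 < p \<Longrightarrow> p \<le> s \<Longrightarrow> s < 1 \<Longrightarrow> q s / s + 4 * c \<le> q p / p + 4 * c"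
  using anti by simp

text \<open>Since \<open>W c\<close> vanishes at both ends, a nonzero extreme value is taken in the
  interior, where its derivative vanishes.\<close>

lemma extremal_zero:
  assumes r0: "r0 \<in> {0..1}" "W c r0 \<noteq> 0"
    and ext: "(\<forall>r\<in>{0..1}. W c r \<le> W c r0) \<or> (\<forall>r\<in>{0..1}. W c r0 \<le> W c r)"
  shows "0 < r0" "r0 < 1" "a r0 - c * (1 - 2 * r0\<^sup>2) = 0"
proof -
  show r01: "0 < r0" "r0 < 1" using r0 W_ends[of c] by (auto simp: less_le)
  have d: "(W c has_real_derivative r0 * (a r0 - c * (1 - 2 * r0\<^sup>2))) (at r0)"
    using dW[OF r0(1), of c] at_inner[OF r01] by simp
  have "r0 * (a r0 - c * (1 - 2 * r0\<^sup>2)) = 0"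
    using ext
  proof
    assume mx: "\<forall>r\<in>{0..1}. W c r \<le> W c r0"
    show ?thesis
      by (rule DERIV_local_max[OF d, of "min r0 (1 - r0)"]) (use mx r01 in \<open>auto simp: abs_less_iff\<close>)
  next
    assume mn: "\<forall>r\<in>{0..1}. W c r0 \<le> W c r"
    show ?thesis
      by (rule DERIV_local_min[OF d, of "min r0 (1 - r0)"]) (use mn r01 in \<open>auto simp: abs_less_iff\<close>)
  qed
  then show "a r0 - c * (1 - 2 * r0\<^sup>2) = 0" using r01 by simp
qed

text \<open>That \<open>q r / r\<close> decreases means that \<open>a\<close> is concave in
  \<open>r\<^sup>2\<close>. Subtracting an affine function of \<open>r\<^sup>2\<close> keeps this,
  so the difference is nonnegative between two of its zeros, and it carries the sign of the
  derivative of \<open>W c\<close>.\<close>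

lemma W_increasing_between:
  assumes "0 \<le> p" "p < s" "s \<le> 1" "a p - c * (1 - 2 * p\<^sup>2) = 0" "a s - c * (1 - 2 * s\<^sup>2) = 0"
  shows "W c p \<le> W c s"
proof (rule DERIV_nonneg_imp_increasing_open[where f = "W c"])
  show "\<exists>y. (W c has_real_derivative y) (at x) \<and> 0 \<le> y" if x: "p < x" "x < s" for x
  proof -
    have "0 \<le> a x - c * (1 - 2 * x\<^sup>2)"
      by (rule nonneg_between_zeros[where p = p and s = s, OF slope_form[OF q0] anti_shift])
        (use assms x in auto)
    then show ?thesis
      using dW[of x c] at_inner[of x] x assms by (intro exI[of _ "x * (a x - c * (1 - 2 * x\<^sup>2))"]) auto
  qed
qed (use assms in \<open>auto intro: continuous_on_subset[OF cont_W]\<close>)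

text \<open>The choice of \<open>c\<close> makes the difference vanish at the wall. A positive
  maximum of \<open>W c\<close> would be another zero of the difference, and \<open>W c\<close>
  would not decrease from there to its value 0 at the wall.\<close>

lemma W_nonpos:
  assumes "a 1 = - c" "r \<in> {0..1}"
  shows "W c r \<le> 0"
proof (rule ccontr)
  assume "\<not> W c r \<le> 0"
  obtain r0 where r0: "r0 \<in> {0..1}" "\<forall>r\<in>{0..1}. W c r \<le> W c r0"
    using continuous_attains_sup[of "{0..1}" "W c"] cont_W by auto
  then have "W c r \<le> W c r0" using assms(2) by blast
  then have pos: "0 < W c r0" using \<open>\<not> W c r \<le> 0\<close> by linarith
  note z = extremal_zero[OF r0(1) _ disjI1[OF r0(2)]]
  have "W c r0 \<le> W c 1"
    by (rule W_increasing_between) (use z pos assms in auto)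
  then show False using W_ends pos by simp
qed

text \<open>The mirror image: the difference vanishes at the axis, and \<open>W c\<close> would not
  decrease from 0 there to a negative minimum.\<close>

lemma W_nonneg:
  assumes "a 0 = c" "r \<in> {0..1}"
  shows "0 \<le> W c r"
proof (rule ccontr)
  assume "\<not> 0 \<le> W c r"
  obtain r0 where r0: "r0 \<in> {0..1}" "\<forall>r\<in>{0..1}. W c r0 \<le> W c r"
    using continuous_attains_inf[of "{0..1}" "W c"] cont_W by auto
  then have "W c r0 \<le> W c r" using assms(2) by blast
  then have neg: "W c r0 < 0" using \<open>\<not> 0 \<le> W c r\<close> by linarith
  note z = extremal_zero[OF r0(1) _ disjI2[OF r0(2)]]
  have "W c 0 \<le> W c r0"
    by (rule W_increasing_between) (use z neg assms in auto)
  then show False using W_ends neg by simp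
qed

text \<open>With \<open>c = - a 1\<close> both factors in \<open>energy_bound\<close> are
  nonpositive; mean zero and monotonicity give \<open>a 1 \<le> 0\<close>.\<close>

lemma energy_bound_decreasing:
  assumes q: "\<forall>r\<in>{0..1}. q r \<le> 0"
  shows "integral {0..1} (\<lambda>r. r * (a r)\<^sup>2) \<le> (a 1)\<^sup>2 / 6"
proof -
  have "a 1 \<le> 0"
  proof (rule ccontr)
    assume "\<not> a 1 \<le> 0"
    moreover have "a 1 \<le> a r" if "r \<in> {0<..<1}" for r
      using nonincreasing[OF q, of r 1] that by auto
    ultimately show False using not_positive by force
  qed
  have "0 \<le> (q r - 4 * (- a 1) * r) * W (- a 1) r" if "r \<in> {0..1}" for r
  proof (intro mult_nonpos_nonpos)
    have "4 * a 1 * r \<le> 0" using \<open>a 1 \<le> 0\<close> that by (simp add: mult_nonpos_nonneg)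
    moreover have "q r \<le> 0" using q that by blast
    ultimately show "q r - 4 * (- a 1) * r \<le> 0" by linarith
  qed (use W_nonpos that in auto)
  then show ?thesis using energy_bound[of "- a 1"] by simp
qed

text \<open>Here \<open>c = a 0\<close>, which is nonpositive, and both factors are
  nonnegative.\<close>

lemma energy_bound_increasing:
  assumes q: "\<forall>r\<in>{0..1}. 0 \<le> q r"
  shows "integral {0..1} (\<lambda>r. r * (a r)\<^sup>2) \<le> (a 0)\<^sup>2 / 6"
proof -
  have a0: "a 0 \<le> 0"
  proof (rule ccontr)
    assume "\<not> a 0 \<le> 0"
    moreover have "a 0 \<le> a r" if "r \<in> {0<..<1}" for r
      using nondecreasing[OF q, of 0 r] that by auto
    ultimately show False using not_positive by force
  qed
  have "0 \<le> (q r - 4 * a 0 * r) * W (a 0) r" if "r \<in> {0..1}" for r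
  proof (intro mult_nonneg_nonneg)
    have "4 * a 0 * r \<le> 0" using a0 that by (simp add: mult_nonpos_nonneg)
    moreover have "0 \<le> q r" using q that by blast
    ultimately show "0 \<le> q r - 4 * a 0 * r" by linarith
  qed (use W_nonneg that in auto)
  then show ?thesis using energy_bound[of "a 0"] by simp
qed

end

end

section \<open>The closed equation on the moving line\<close>

text \<open>On the line \<open>x = X t\<close> the field \<open>a = \<partial>\<^sub>x u\<^sup>x\<close>, together with \<open>\<beta> = u\<^sup>r\<close>, solves a closed equation;
  \<open>q\<close>, \<open>m\<close>, \<open>n\<close> are the successive radial derivatives of \<open>a\<close>.\<close>

locale line_flow =
  fixes T :: real and a q m n \<beta> \<beta>r \<beta>rr :: "real \<Rightarrow> real \<Rightarrow> real" and P :: "real \<Rightarrow> real"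
  assumes T: "0 < T"
    and cont: "continuous_on ({0..<T} \<times> {0..1}) (\<lambda>(t, r). a t r)"
      "continuous_on ({0..<T} \<times> {0..1}) (\<lambda>(t, r). q t r)"
      "continuous_on ({0..<T} \<times> {0..1}) (\<lambda>(t, r). m t r)"
      "continuous_on ({0..<T} \<times> {0..1}) (\<lambda>(t, r). n t r)"
      "continuous_on ({0..<T} \<times> {0..1}) (\<lambda>(t, r). \<beta> t r)"
      "continuous_on ({0..<T} \<times> {0..1}) (\<lambda>(t, r). \<beta>r t r)"
      "continuous_on ({0..<T} \<times> {0..1}) (\<lambda>(t, r). \<beta>rr t r)"
    and da: "\<And>t r. t \<in> {0..<T} \<Longrightarrow> r \<in> {0..1} \<Longrightarrow> ((\<lambda>r. a t r) has_real_derivative q t r) (at r within {0..1})"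
    and dq: "\<And>t r. t \<in> {0..<T} \<Longrightarrow> r \<in> {0..1} \<Longrightarrow> ((\<lambda>r. q t r) has_real_derivative m t r) (at r within {0..1})"
    and dm: "\<And>t r. t \<in> {0..<T} \<Longrightarrow> r \<in> {0..1} \<Longrightarrow> ((\<lambda>r. m t r) has_real_derivative n t r) (at r within {0..1})"
    and d\<beta>: "\<And>t r. t \<in> {0..<T} \<Longrightarrow> r \<in> {0..1} \<Longrightarrow> ((\<lambda>r. \<beta> t r) has_real_derivative \<beta>r t r) (at r within {0..1})"
    and d\<beta>r: "\<And>t r. t \<in> {0..<T} \<Longrightarrow> r \<in> {0..1} \<Longrightarrow> ((\<lambda>r. \<beta>r t r) has_real_derivative \<beta>rr t r) (at r within {0..1})"
    and divfree: "\<And>t r. t \<in> {0..<T} \<Longrightarrow> r \<in> {0..1} \<Longrightarrow> r * \<beta>r t r + \<beta> t r = - r * a t r"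
    and wall: "\<And>t. t \<in> {0..<T} \<Longrightarrow> \<beta> t 0 = 0" "\<And>t. t \<in> {0..<T} \<Longrightarrow> \<beta> t 1 = 0"
    and axis: "\<And>t. t \<in> {0..<T} \<Longrightarrow> q t 0 = 0"
    and at: "\<And>t r. t \<in> {0<..<T} \<Longrightarrow> r \<in> {0..1} \<Longrightarrow>
      ((\<lambda>t. a t r) has_real_derivative P t - (a t r)\<^sup>2 - \<beta> t r * q t r) (at t)"
    and P: "\<And>t. t \<in> {0<..<T} \<Longrightarrow> P t = 4 * integral {0..1} (\<lambda>r. r * (a t r)\<^sup>2)"
begin

lemma profile:
  assumes t: "t \<in> {0..<T}"
  shows "profile (a t) (q t) (\<lambda>r. r * \<beta> t r)"
proof
  show "((\<lambda>r. r * \<beta> t r) has_real_derivative - (r * a t r)) (at r within {0..1})" if r: "r \<in> {0..1}" for r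
  proof -
    have "((\<lambda>r. r * \<beta> t r) has_real_derivative r * \<beta>r t r + \<beta> t r) (at r within {0..1})"
      using d\<beta>[OF t r] by (auto intro!: derivative_eq_intros)
    then show ?thesis using divfree[OF t r] by simp
  qed
qed (use da wall t in auto)

text \<open>The first and second radial derivatives of the right-hand side of the equation for
  \<open>a\<close>; \<open>P t\<close> drops out because it does not depend on
  \<open>r\<close>.\<close>

definition "Gq t r = - 2 * a t r * q t r - (\<beta>r t r * q t r + \<beta> t r * m t r)"
definition "Gm t r = - 2 * (q t r)\<^sup>2 - 2 * a t r * m t r
  - (\<beta>rr t r * q t r + 2 * \<beta>r t r * m t r + \<beta> t r * n t r)"

lemma cont_sub: "continuous_on ({0..<T} \<times> {0..1}) f \<Longrightarrow> continuous_on ({0<..<T} \<times> {0..1::real}) f"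
  by (erule continuous_on_subset) auto

lemma qt:
  assumes "t \<in> {0<..<T}" "r \<in> {0..1}"
  shows "((\<lambda>t. q t r) has_real_derivative Gq t r) (at t)"
proof (rule interchange_derivatives[where f = a and q = q and Gr = Gq and a = 0 and b = T and c = 0 and d = 1 and G = "\<lambda>t r. P t - (a t r)\<^sup>2 - \<beta> t r * q t r"])
  show "((\<lambda>r. P t - (a t r)\<^sup>2 - \<beta> t r * q t r) has_real_derivative Gq t r) (at r within {0..1})"
    if "t \<in> {0<..<T}" "r \<in> {0..1}" for t r
    using that by (auto intro!: derivative_eq_intros da d\<beta> dq simp: Gq_def algebra_simps)
  show "continuous_on ({0<..<T} \<times> {0..1}) (\<lambda>(t, r). Gq t r)"
    using cont[THEN cont_sub] unfolding Gq_def case_prod_unfold by (intro continuous_intros) auto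
qed (use at da assms in auto)

lemma mt:
  assumes "t \<in> {0<..<T}" "r \<in> {0..1}"
  shows "((\<lambda>t. m t r) has_real_derivative Gm t r) (at t)"
proof (rule interchange_derivatives[where f = q and G = Gq and q = m and Gr = Gm and a = 0 and b = T and c = 0 and d = 1])
  show "((\<lambda>r. Gq t r) has_real_derivative Gm t r) (at r within {0..1})"
    if "t \<in> {0<..<T}" "r \<in> {0..1}" for t r
    using that unfolding Gq_def
    by (auto intro!: derivative_eq_intros da d\<beta> d\<beta>r dq dm simp: Gm_def algebra_simps power2_eq_square)
  show "continuous_on ({0<..<T} \<times> {0..1}) (\<lambda>(t, r). Gm t r)"
    using cont[THEN cont_sub] unfolding Gm_def case_prod_unfold by (intro continuous_intros) auto
qed (use qt dq assms in auto)

text \<open>The radial derivative of \<open>divfree\<close>, kept multiplied by \<open>r\<close> so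
  that it also holds on the axis.\<close>

lemma \<beta>rr_eq:
  assumes t: "t \<in> {0..<T}" and r: "r \<in> {0..1}"
  shows "r * \<beta>rr t r = - a t r - r * q t r - 2 * \<beta>r t r"
proof -
  have "((\<lambda>r. r * \<beta>r t r + \<beta> t r) has_real_derivative r * \<beta>rr t r + 2 * \<beta>r t r) (at r within {0..1})"
    using t r by (auto intro!: derivative_eq_intros d\<beta> d\<beta>r)
  moreover have "((\<lambda>r. r * \<beta>r t r + \<beta> t r) has_real_derivative - a t r - r * q t r) (at r within {0..1})"
    by (rule has_field_derivative_transform[OF r divfree[OF t]])
      (use t r in \<open>auto intro!: derivative_eq_intros da\<close>)
  ultimately have "r * \<beta>rr t r + 2 * \<beta>r t r = - a t r - r * q t r"
    using vector_derivative_unique_within_closed_interval[of 0 1 r "\<lambda>r. r * \<beta>r t r + \<beta> t r"] r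
    by (simp add: has_real_derivative_iff_has_vector_derivative)
  then show ?thesis by simp
qed

text \<open>Apart from the transport term, the equation for \<open>q\<close> is linear and
  homogeneous in \<open>q\<close>, so the maximum principle preserves its sign. The constant
  \<sigma> is 1 for profiles decreasing in \<open>r\<close> and -1 for increasing ones.\<close>

lemma slope_sign:
  assumes \<sigma>: "\<And>r. r \<in> {0..1} \<Longrightarrow> \<sigma> * q 0 r \<le> 0" and t: "t \<in> {0..<T}" and r: "r \<in> {0..1}"
  shows "\<sigma> * q t r \<le> 0"
proof -
  have "continuous_on ({0..<T} \<times> {0..1}) (\<lambda>(t, r). - (2 * a t r + \<beta>r t r))"
    using cont unfolding case_prod_unfold by (intro continuous_intros)
  then obtain K where K: "\<And>s r. s \<in> {0..t} \<Longrightarrow> r \<in> {0..1} \<Longrightarrow> \<bar>- (2 * a s r + \<beta>r s r)\<bar> \<le> K"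
    using bounded_before[where \<tau> = t and T = T] t by auto
  show ?thesis
  proof (rule max_principle[where h = "\<lambda>t r. \<sigma> * q t r" and \<tau> = t and K = K])
    have "continuous_on ({0..t} \<times> {0..1}) (\<lambda>(t, r). q t r)"
      by (rule continuous_on_subset[OF cont(2)]) (use t in auto)
    then show "continuous_on ({0..t} \<times> {0..1}) (\<lambda>(t, r). \<sigma> * q t r)"
      unfolding case_prod_unfold by (intro continuous_intros)
  next
    fix s r assume s: "0 < s" "s \<le> t" and r: "r \<in> {0..1}" and pos: "0 < \<sigma> * q s r"
      and mx: "\<And>r'. r' \<in> {0..1} \<Longrightarrow> \<sigma> * q s r' \<le> \<sigma> * q s r"
    have s': "s \<in> {0<..<T}" "s \<in> {0..<T}" using s t by auto
    have "\<beta> s r * (\<sigma> * m s r) = 0"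
      by (rule critical_transport_term[where f = "\<lambda>r. \<sigma> * q s r"])
        (use dq s' r mx wall in \<open>auto intro!: derivative_eq_intros\<close>)
    then have "\<sigma> * Gq s r = - (2 * a s r + \<beta>r s r) * (\<sigma> * q s r)"
      by (simp add: Gq_def algebra_simps)
    also have "\<dots> \<le> K * (\<sigma> * q s r)"
      using K[of s r] s r pos by (intro mult_right_mono) auto
    finally show "\<exists>D. ((\<lambda>t. \<sigma> * q t r) has_real_derivative D) (at s) \<and> D \<le> K * (\<sigma> * q s r)"
      using qt[OF s'(1) r] by (intro exI[of _ "\<sigma> * Gq s r"]) (auto intro!: derivative_eq_intros)
  qed (use t r \<sigma> in auto)
qed

text \<open>Up to the factor \<open>r\<^sup>3\<close> the quantity \<open>r m - q\<close> is \<open>L\<^sub>r\<^sup>2 a\<close>, but it is regular at the axis.\<close>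

lemma concavity:
  assumes init: "\<And>r. r \<in> {0..1} \<Longrightarrow> r * m 0 r - q 0 r \<le> 0" and t: "t \<in> {0..<T}" and r: "r \<in> {0..1}"
  shows "r * m t r - q t r \<le> 0"
proof -
  have "continuous_on ({0..<T} \<times> {0..1}) (\<lambda>(t, r). - (3 * (a t r + \<beta>r t r)))"
    using cont unfolding case_prod_unfold by (intro continuous_intros)
  then obtain K where K: "\<And>s r. s \<in> {0..t} \<Longrightarrow> r \<in> {0..1} \<Longrightarrow> \<bar>- (3 * (a s r + \<beta>r s r))\<bar> \<le> K"
    using bounded_before[where \<tau> = t and T = T] t by auto
  show ?thesis
  proof (rule max_principle[where h = "\<lambda>t r. r * m t r - q t r" and \<tau> = t and K = K])
    have "continuous_on ({0..t} \<times> {0..1}) (\<lambda>(t, r). q t r)" "continuous_on ({0..t} \<times> {0..1}) (\<lambda>(t, r). m t r)"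
      by (rule continuous_on_subset[OF cont(2)] continuous_on_subset[OF cont(3)]; use t in auto)+
    then show "continuous_on ({0..t} \<times> {0..1}) (\<lambda>(t, r). r * m t r - q t r)"
      unfolding case_prod_unfold by (intro continuous_intros)
  next
    fix s r assume s: "0 < s" "s \<le> t" and r: "r \<in> {0..1}" and pos: "0 < r * m s r - q s r"
      and mx: "\<And>r'. r' \<in> {0..1} \<Longrightarrow> r' * m s r' - q s r' \<le> r * m s r - q s r"
    have s': "s \<in> {0<..<T}" "s \<in> {0..<T}" using s t by auto
    have "((\<lambda>r. r * m s r - q s r) has_real_derivative r * n s r) (at r within {0..1})"
      using dq[OF s'(2) r] dm[OF s'(2) r] by (auto intro!: derivative_eq_intros)
    then have crit: "\<beta> s r * (r * n s r) = 0"
      by (rule critical_transport_term) (use s' r mx wall in auto)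
    have \<beta>: "\<beta> s r = - r * a s r - r * \<beta>r s r" using divfree[OF s'(2) r] by simp
    have "r * Gm s r - Gq s r =
        - 2 * r * (q s r)\<^sup>2 - 2 * r * a s r * m s r - (r * \<beta>rr s r) * q s r - 2 * r * \<beta>r s r * m s r
        + 2 * a s r * q s r + \<beta>r s r * q s r + \<beta> s r * m s r - \<beta> s r * (r * n s r)"
      by (simp add: Gm_def Gq_def algebra_simps)
    \<comment> \<open>Eliminating \<beta>rr and \<beta> by incompressibility leaves a multiple of
      \<open>r * m s r - q s r\<close> and a quadratic term of favourable sign, which is why
      concavity persists.\<close>
    also have "\<dots> = - (3 * (a s r + \<beta>r s r)) * (r * m s r - q s r) - r * (q s r)\<^sup>2"
      unfolding crit \<beta>rr_eq[OF s'(2) r] unfolding \<beta> by (simp add: algebra_simps power2_eq_square)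
    also have "\<dots> \<le> - (3 * (a s r + \<beta>r s r)) * (r * m s r - q s r)"
      using r by simp
    also have "\<dots> \<le> K * (r * m s r - q s r)"
      using K[of s r] s r pos by (intro mult_right_mono) auto
    finally show "\<exists>D. ((\<lambda>t. r * m t r - q t r) has_real_derivative D) (at s) \<and> D \<le> K * (r * m s r - q s r)"
      using qt[OF s'(1) r] mt[OF s'(1) r]
      by (intro exI[of _ "r * Gm s r - Gq s r"]) (auto intro!: derivative_eq_intros)
  qed (use t r init in auto)
qed

text \<open>The derivative of \<open>q t r / r\<close> is
  \<open>(r * m t r - q t r) / r\<^sup>2\<close>.\<close>

lemma slope_quotient_decreasing:
  assumes t: "t \<in> {0..<T}" and g: "\<And>r. r \<in> {0<..<1} \<Longrightarrow> r * m t r - q t r \<le> 0"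
    and ps: "0 < p" "p \<le> s" "s \<le> 1"
  shows "q t s / s \<le> q t p / p"
proof (rule DERIV_nonpos_imp_decreasing_open[where f = "\<lambda>r. q t r / r"])
  show "\<exists>y. ((\<lambda>r. q t r / r) has_real_derivative y) (at r) \<and> y \<le> 0" if "p < r" "r < s" for r
  proof -
    have r: "0 < r" "r < 1" using that ps by auto
    then have "at r within {0..1} = at r"
      by (intro at_within_interior) (auto simp: interior_atLeastAtMost_real)
    then have "((\<lambda>r. q t r) has_real_derivative m t r) (at r)" using dq[of t r] t r by simp
    then have "((\<lambda>r. q t r / r) has_real_derivative (r * m t r - q t r) / r\<^sup>2) (at r)"
      using r by (auto intro!: derivative_eq_intros simp: power2_eq_square algebra_simps)
    moreover have "(r * m t r - q t r) / r\<^sup>2 \<le> 0" using g[of r] r by (simp add: divide_nonpos_pos)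
    ultimately show ?thesis by blast
  qed
  have "continuous_on {0..1} (q t)" by (rule DERIV_continuous_on) (rule dq[OF t])
  then have "continuous_on {p..s} (q t)" by (rule continuous_on_subset) (use ps in auto)
  then show "continuous_on {p..s} (\<lambda>r. q t r / r)"
    by (intro continuous_intros) (use ps in auto)
qed (use ps in auto)

lemma initial_strict:
  assumes g: "\<And>r. r \<in> {0<..<1} \<Longrightarrow> r * m 0 r - q 0 r < 0" and ps: "0 < p" "p < s" "s \<le> 1"
  shows "q 0 s / s < q 0 p / p"
proof (rule DERIV_neg_imp_decreasing_open[where f = "\<lambda>r. q 0 r / r"])
  show "\<exists>y. ((\<lambda>r. q 0 r / r) has_real_derivative y) (at r) \<and> y < 0" if "p < r" "r < s" for r
  proof -
    have r: "0 < r" "r < 1" using that ps by auto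
    then have "at r within {0..1} = at r"
      by (intro at_within_interior) (auto simp: interior_atLeastAtMost_real)
    then have "((\<lambda>r. q 0 r) has_real_derivative m 0 r) (at r)" using dq[of 0 r] T r by simp
    then have "((\<lambda>r. q 0 r / r) has_real_derivative (r * m 0 r - q 0 r) / r\<^sup>2) (at r)"
      using r by (auto intro!: derivative_eq_intros simp: power2_eq_square algebra_simps)
    moreover have "(r * m 0 r - q 0 r) / r\<^sup>2 < 0" using g[of r] r by (simp add: divide_neg_pos)
    ultimately show ?thesis by blast
  qed
  have "continuous_on {0..1} (q 0)" by (rule DERIV_continuous_on) (rule dq, use T in auto)
  then have "continuous_on {p..s} (q 0)" by (rule continuous_on_subset) (use ps in auto)
  then show "continuous_on {p..s} (\<lambda>r. q 0 r / r)"
    by (intro continuous_intros) (use ps in auto)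
qed (use ps in auto)

text \<open>The radial velocity vanishes at the endpoint \<open>e\<close>, so \<open>a t e\<close>
  solves an ordinary differential equation. As \<open>P t\<close> is at most \<open>4 / 6\<close> of
  \<open>(a t e)\<^sup>2\<close>, the function \<open>- a t e\<close> grows at least at the rate of
  one third of its square.\<close>

lemma lifespan_general:
  assumes e: "e = 0 \<or> e = 1" and neg: "a 0 e < 0"
    and bound: "\<And>t. t \<in> {0<..<T} \<Longrightarrow> integral {0..1} (\<lambda>r. r * (a t r)\<^sup>2) \<le> (a t e)\<^sup>2 / 6"
  shows "T \<le> 3 / - a 0 e"
proof -
  have "T \<le> 1 / (1 / 3 * - a 0 e)"
  proof (rule riccati_lifespan[where y = "\<lambda>t. - a t e"])
    have "continuous_on {0..<T} (\<lambda>t. (\<lambda>(t, r). a t r) (t, e))"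
      by (rule continuous_on_compose2[OF cont(1)]) (use e in \<open>auto intro!: continuous_intros\<close>)
    then show "continuous_on {0..<T} (\<lambda>t. - a t e)" by (simp add: continuous_on_minus)
    show "\<exists>D. ((\<lambda>t. - a t e) has_real_derivative D) (at t) \<and> 1 / 3 * (- a t e)\<^sup>2 \<le> D" if "0 < t" "t < T" for t
    proof -
      have t: "t \<in> {0<..<T}" using that by auto
      have "\<beta> t e = 0" using wall e that by auto
      then have "((\<lambda>t. - a t e) has_real_derivative - (P t - (a t e)\<^sup>2)) (at t)"
        using DERIV_minus[OF at[OF t, of e]] e by auto
      moreover have "1 / 3 * (- a t e)\<^sup>2 \<le> - (P t - (a t e)\<^sup>2)"
        using bound[OF t] P[OF t] by simp
      ultimately show ?thesis by blast
    qed
  qed (use neg in auto)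
  then show ?thesis by simp
qed

context
  assumes g0: "\<And>r. r \<in> {0<..<1} \<Longrightarrow> r * m 0 r - q 0 r < 0"
begin

lemma g0_weak:
  assumes "r \<in> {0..1}"
  shows "r * m 0 r - q 0 r \<le> 0"
proof (rule continuous_le_on_closure[where f = "\<lambda>r. r * m 0 r - q 0 r" and S = "{0<..<1}" and a = 0])
  have "continuous_on {0..1} (q 0)" "continuous_on {0..1} (m 0)"
    by (rule DERIV_continuous_on, rule dq dm, use T in auto)+
  then show "continuous_on (closure {0<..<1}) (\<lambda>r. r * m 0 r - q 0 r)"
    by (auto intro!: continuous_intros)
qed (use assms g0 in \<open>auto intro: less_imp_le\<close>)

lemma anti:
  assumes "t \<in> {0..<T}" "0 < p" "p \<le> s" "s < 1"
  shows "q t s / s \<le> q t p / p"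
  by (rule slope_quotient_decreasing) (use assms concavity[OF g0_weak] in auto)

text \<open>The hypothesis says that \<open>q 0 r / r\<close> tends to 0 at the axis. As this
  quotient strictly decreases, \<open>q 0\<close> is negative away from the axis; so
  \<open>a 0\<close> is smallest at the wall, where mean zero makes it negative.\<close>

lemma lifespan_axis:
  assumes m0: "m 0 0 = 0"
  shows "T \<le> 3 / - a 0 1" "a 0 1 < 0"
proof -
  have T0: "0 \<in> {0..<T}" using T by simp
  have lim: "((\<lambda>r. q 0 r / r) \<longlongrightarrow> 0) (at_right 0)"
  proof -
    have "((\<lambda>r. q 0 r) has_real_derivative 0) (at 0 within {0..1})" using dq[of 0 0] T m0 by simp
    then have "((\<lambda>r. (q 0 r - q 0 0) / (r - 0)) \<longlongrightarrow> 0) (at 0 within {0..1})"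
      by (simp add: has_field_derivative_iff)
    then show ?thesis
      using axis[OF T0] at_within_Icc_at_right[of 0 "1::real"] by simp
  qed
  have neg: "q 0 s < 0" if "0 < s" "s \<le> 1" for s
  proof -
    \<comment> \<open>The limit at the axis gives only a weak inequality at \<open>s/2\<close>; the
      strict decrease from \<open>s/2\<close> to \<open>s\<close> restores strictness.\<close>
    have "\<forall>\<^sub>F p in at_right 0. q 0 (s/2) / (s/2) \<le> q 0 p / p"
      unfolding eventually_at_right_field
      using slope_quotient_decreasing[OF T0 less_imp_le[OF g0], of _ "s/2"] that
      by (intro exI[of _ "s/2"]) auto
    then have "q 0 (s/2) / (s/2) \<le> 0"
      by (intro tendsto_lowerbound[OF lim]) auto
    moreover have "q 0 s / s < q 0 (s/2) / (s/2)" by (rule initial_strict[OF g0]) (use that in auto)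
    ultimately have "q 0 s / s < 0" by linarith
    then show ?thesis using that by (simp add: divide_less_0_iff)
  qed
  interpret p0: profile "a 0" "q 0" "\<lambda>r. r * \<beta> 0 r" by (rule profile[OF T0])
  show "a 0 1 < 0"
  proof (rule ccontr)
    assume "\<not> a 0 1 < 0"
    moreover have "a 0 1 < a 0 r" if "r \<in> {0<..<1}" for r
      by (rule p0.decreasing) (use that neg in auto)
    ultimately show False using p0.not_positive by force
  qed
  have q0: "1 * q 0 r \<le> 0" if "r \<in> {0..1}" for r
    using neg[of r] axis[OF T0] that by (cases "r = 0") auto
  show "T \<le> 3 / - a 0 1"
  proof (rule lifespan_general)
    fix t assume "t \<in> {0<..<T}"
    then have t: "t \<in> {0..<T}" by auto
    interpret pt: profile "a t" "q t" "\<lambda>r. r * \<beta> t r" by (rule profile[OF t])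
    show "integral {0..1} (\<lambda>r. r * (a t r)\<^sup>2) \<le> (a t 1)\<^sup>2 / 6"
      by (rule pt.energy_bound_decreasing[OF axis[OF t] anti[OF t]])
        (use slope_sign[OF q0 t] in auto)
  qed (use \<open>a 0 1 < 0\<close> in auto)
qed

text \<open>Now the decreasing quotient \<open>q 0 r / r\<close> ends at 0 on the wall, so
  \<open>q 0\<close> is positive inside and \<open>a 0\<close> is smallest, hence negative, at the
  axis.\<close>

lemma lifespan_wall:
  assumes q1: "q 0 1 = 0"
  shows "T \<le> 3 / - a 0 0" "a 0 0 < 0"
proof -
  have T0: "0 \<in> {0..<T}" using T by simp
  have pos: "0 < q 0 s" if "0 < s" "s < 1" for s
  proof -
    have "q 0 1 / 1 < q 0 s / s" by (rule initial_strict[OF g0]) (use that in auto)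
    then show ?thesis using q1 that by (simp add: zero_less_divide_iff)
  qed
  interpret p0: profile "a 0" "q 0" "\<lambda>r. r * \<beta> 0 r" by (rule profile[OF T0])
  show "a 0 0 < 0"
  proof (rule ccontr)
    assume "\<not> a 0 0 < 0"
    moreover have "a 0 0 < a 0 r" if "r \<in> {0<..<1}" for r
      by (rule p0.increasing) (use that pos in auto)
    ultimately show False using p0.not_positive by force
  qed
  have q0: "-1 * q 0 r \<le> 0" if "r \<in> {0..1}" for r
    using pos[of r] axis[OF T0] q1 that by (cases "r = 0 \<or> r = 1") auto
  show "T \<le> 3 / - a 0 0"
  proof (rule lifespan_general)
    fix t assume "t \<in> {0<..<T}"
    then have t: "t \<in> {0..<T}" by auto
    interpret pt: profile "a t" "q t" "\<lambda>r. r * \<beta> t r" by (rule profile[OF t])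
    show "integral {0..1} (\<lambda>r. r * (a t r)\<^sup>2) \<le> (a t 0)\<^sup>2 / 6"
      by (rule pt.energy_bound_increasing[OF axis[OF t] anti[OF t]])
        (use slope_sign[OF q0 t] in auto)
  qed (use \<open>a 0 0 < 0\<close> in auto)
qed

end

end

section \<open>Reduction of the axisymmetric system\<close>

definition slab :: "real \<Rightarrow> (real \<times> real \<times> real) set" where
  "slab T = {0..<T} \<times> UNIV \<times> {0..1}"

definition cont_slab :: "real \<Rightarrow> (real \<Rightarrow> real \<Rightarrow> real \<Rightarrow> real) \<Rightarrow> bool" where
  "cont_slab T f \<longleftrightarrow> continuous_on (slab T) (\<lambda>(t, x, r). f t x r)"

text \<open>Total differentiability relative to the closed tube, one-sided at its boundary, is what
  the chain rule along the moving line requires.\<close>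

definition has_partials ::
  "real \<Rightarrow> (real \<Rightarrow> real \<Rightarrow> real \<Rightarrow> real) \<Rightarrow> (real \<Rightarrow> real \<Rightarrow> real \<Rightarrow> real) \<Rightarrow>
   (real \<Rightarrow> real \<Rightarrow> real \<Rightarrow> real) \<Rightarrow> (real \<Rightarrow> real \<Rightarrow> real \<Rightarrow> real) \<Rightarrow> bool" where
  "has_partials T f ft fx fr \<longleftrightarrow> cont_slab T ft \<and> cont_slab T fx \<and> cont_slab T fr \<and>
     (\<forall>a\<in>slab T. ((\<lambda>(t, x, r). f t x r) has_derivative
        (\<lambda>(h, k, l). case a of (t, x, r) \<Rightarrow> h * ft t x r + k * fx t x r + l * fr t x r)) (at a within slab T))"

lemma Ck_on_continuous_on: "Ck_on k S f \<Longrightarrow> continuous_on S f"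
  by (cases k) (auto intro: has_derivative_continuous_on)

text \<open>The partial derivatives are the values of the total derivative on the basis vectors,
  which are as regular as \<open>Ck_on\<close> grants for every fixed direction.\<close>

lemma Ck_on_partials:
  assumes "Ck_on (Suc k) (slab T) (\<lambda>(t, x, r). f t x r)"
  obtains ft fx fr where "has_partials T f ft fx fr"
    "Ck_on k (slab T) (\<lambda>(t, x, r). ft t x r)" "Ck_on k (slab T) (\<lambda>(t, x, r). fx t x r)"
    "Ck_on k (slab T) (\<lambda>(t, x, r). fr t x r)"
proof -
  obtain f' where f': "\<And>a. a \<in> slab T \<Longrightarrow> ((\<lambda>(t, x, r). f t x r) has_derivative f' a) (at a within slab T)"
    "\<And>v. Ck_on k (slab T) (\<lambda>a. f' a v)"
    using assms by auto
  define ft where "ft = (\<lambda>t x r. f' (t, x, r) (1, 0, 0))"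
  define fx where "fx = (\<lambda>t x r. f' (t, x, r) (0, 1, 0))"
  define fr where "fr = (\<lambda>t x r. f' (t, x, r) (0, 0, 1))"
  have C: "Ck_on k (slab T) (\<lambda>(t, x, r). ft t x r)" "Ck_on k (slab T) (\<lambda>(t, x, r). fx t x r)"
    "Ck_on k (slab T) (\<lambda>(t, x, r). fr t x r)"
    using f'(2) by (simp_all add: ft_def fx_def fr_def case_prod_unfold)
  have "f' a = (\<lambda>(h, k, l). case a of (t, x, r) \<Rightarrow> h * ft t x r + k * fx t x r + l * fr t x r)"
    if "a \<in> slab T" for a
  proof
    fix v :: "real \<times> real \<times> real"
    obtain h k l where v: "v = (h, k, l)" by (cases v)
    have lin: "linear (f' a)" using f'(1)[OF that] by (rule has_derivative_linear)
    have "v = h *\<^sub>R (1, 0, 0) + k *\<^sub>R (0, 1, 0) + l *\<^sub>R (0, 0, 1)" by (simp add: v)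
    then have "f' a v = h * f' a (1, 0, 0) + k * f' a (0, 1, 0) + l * f' a (0, 0, 1)"
      by (simp only: linear_add[OF lin] linear_scale[OF lin] real_scaleR_def)
    then show "f' a v = (case v of (h, k, l) \<Rightarrow> case a of (t, x, r) \<Rightarrow> h * ft t x r + k * fx t x r + l * fr t x r)"
      by (simp add: v ft_def fx_def fr_def case_prod_unfold)
  qed
  then have "has_partials T f ft fx fr"
    using f'(1) C[THEN Ck_on_continuous_on] by (simp add: has_partials_def cont_slab_def)
  then show ?thesis using C that by blast
qed

lemma has_partials_cont:
  assumes "has_partials T f ft fx fr"
  shows "cont_slab T f" "cont_slab T ft" "cont_slab T fx" "cont_slab T fr"
  using assms by (auto simp: has_partials_def cont_slab_def intro: has_derivative_continuous_on)

lemma has_partials_chain: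
  assumes f: "has_partials T f ft fx fr"
    and g: "\<And>y. y \<in> S \<Longrightarrow> (g1 y, g2 y, g3 y) \<in> slab T" and s: "s \<in> S"
    and d: "(g1 has_real_derivative d1) (at s within S)" "(g2 has_real_derivative d2) (at s within S)"
      "(g3 has_real_derivative d3) (at s within S)"
  shows "((\<lambda>y. f (g1 y) (g2 y) (g3 y)) has_real_derivative
    d1 * ft (g1 s) (g2 s) (g3 s) + d2 * fx (g1 s) (g2 s) (g3 s) + d3 * fr (g1 s) (g2 s) (g3 s)) (at s within S)"
proof -
  have "((\<lambda>y. (g1 y, g2 y, g3 y)) has_derivative (\<lambda>h. (d1 * h, d2 * h, d3 * h))) (at s within S)"
    using d by (intro has_derivative_Pair) (auto simp: has_field_derivative_def)
  then have "((\<lambda>y. (\<lambda>(t, x, r). f t x r) (g1 y, g2 y, g3 y)) has_derivative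
      (\<lambda>h. (\<lambda>(h, k, l). case (g1 s, g2 s, g3 s) of (t, x, r) \<Rightarrow>
        h * ft t x r + k * fx t x r + l * fr t x r) (d1 * h, d2 * h, d3 * h))) (at s within S)"
    by (rule has_derivative_in_compose2[where t = "slab T", rotated -1])
      (use f g s in \<open>auto simp: has_partials_def\<close>)
  then show ?thesis
    unfolding has_field_derivative_def case_prod_conv
    by (rule has_derivative_eq_rhs) (auto simp: algebra_simps)
qed

lemma has_partials_curve:
  assumes "has_partials T f ft fx fr" "t \<in> {0<..<T}" "r \<in> {0..1}" "(X has_real_derivative X') (at t)"
  shows "((\<lambda>s. f s (X s) r) has_real_derivative ft t (X t) r + X' * fx t (X t) r) (at t)"
proof -
  have "((\<lambda>s. f s (X s) r) has_real_derivative
      1 * ft t (X t) r + X' * fx t (X t) r + 0 * fr t (X t) r) (at t within {0<..<T})"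
  proof (rule has_partials_chain[OF assms(1) _ assms(2)])
    show "(X has_real_derivative X') (at t within {0<..<T})"
      by (rule has_field_derivative_at_within[OF assms(4)])
  qed (use assms in \<open>auto simp: slab_def\<close>)
  then show ?thesis by (simp add: at_within_open[OF assms(2)])
qed

lemma has_partials_t:
  assumes "has_partials T f ft fx fr" "t \<in> {0<..<T}" "r \<in> {0..1}"
  shows "((\<lambda>s. f s x r) has_real_derivative ft t x r) (at t)"
  using has_partials_curve[OF assms, of "\<lambda>_. x" 0] by simp

lemma has_partials_x:
  assumes "has_partials T f ft fx fr" "t \<in> {0..<T}" "r \<in> {0..1}"
  shows "((\<lambda>x. f t x r) has_real_derivative fx t x r) (at x within S)"
proof -
  have "((\<lambda>x. f t x r) has_real_derivative
      0 * ft t x r + 1 * fx t x r + 0 * fr t x r) (at x)"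
    by (rule has_partials_chain[OF assms(1)]) (use assms in \<open>auto simp: slab_def\<close>)
  then have "((\<lambda>x. f t x r) has_real_derivative fx t x r) (at x)" by simp
  then show ?thesis by (rule has_field_derivative_at_within)
qed

lemma has_partials_r:
  assumes "has_partials T f ft fx fr" "t \<in> {0..<T}" "r \<in> {0..1}"
  shows "((\<lambda>r. f t x r) has_real_derivative fr t x r) (at r within {0..1})"
proof -
  have "((\<lambda>r. f t x r) has_real_derivative
      0 * ft t x r + 0 * fx t x r + 1 * fr t x r) (at r within {0..1})"
    by (rule has_partials_chain[OF assms(1)]) (use assms in \<open>auto simp: slab_def\<close>)
  then show ?thesis by simp
qed

lemma cont_slab_compose:
  assumes "cont_slab T f" "continuous_on S g1" "continuous_on S g2" "continuous_on S g3"
    "\<And>y. y \<in> S \<Longrightarrow> (g1 y, g2 y, g3 y) \<in> slab T"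
  shows "continuous_on S (\<lambda>y. f (g1 y) (g2 y) (g3 y))"
proof -
  have "continuous_on S (\<lambda>y. (\<lambda>(t, x, r). f t x r) (g1 y, g2 y, g3 y))"
    by (rule continuous_on_compose2[OF assms(1)[unfolded cont_slab_def]])
      (use assms in \<open>auto intro!: continuous_intros\<close>)
  then show ?thesis by simp
qed

lemma cont_slab_line:
  assumes "cont_slab T f" "continuous_on {0..<T} X"
  shows "continuous_on ({0..<T} \<times> {0..1}) (\<lambda>(t, r). f t (X t) r)"
  unfolding case_prod_unfold
  by (rule cont_slab_compose[OF assms(1)])
    (auto intro!: continuous_intros continuous_on_compose2[OF assms(2)] simp: slab_def)

lemma cont_slab_r: "cont_slab T f \<Longrightarrow> t \<in> {0..<T} \<Longrightarrow> continuous_on {0..1} (\<lambda>r. f t x r)"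
  by (erule cont_slab_compose) (auto intro!: continuous_intros simp: slab_def)

lemma cont_slab_t: "cont_slab T f \<Longrightarrow> r \<in> {0..1} \<Longrightarrow> continuous_on {0..<T} (\<lambda>t. f t x r)"
  by (erule cont_slab_compose) (auto intro!: continuous_intros simp: slab_def)

text \<open>The equations are imposed only for positive times; continuity carries them to time 0,
  where the datum is examined.\<close>

lemma zero_at_initial_time:
  fixes k :: "real \<Rightarrow> real"
  assumes "continuous_on {0..<T} k" "0 < T" "\<And>t. t \<in> {0<..<T} \<Longrightarrow> k t = 0" "t \<in> {0..<T}"
  shows "k t = 0"
proof (cases "t = 0")
  case True
  show ?thesis
  proof (rule continuous_constant_on_closure[where S = "{0<..<T/2}" and f = k])
    show "continuous_on (closure {0<..<T/2}) k"
      by (rule continuous_on_subset[OF assms(1)]) (use assms(2) in auto)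
    show "t \<in> closure {0<..<T/2}" using assms(2) True by simp
  qed (use assms in auto)
qed (use assms in auto)

lemma zero_on_slab:
  assumes k: "cont_slab T k" and T: "0 < T"
    and z: "\<And>t r. t \<in> {0<..<T} \<Longrightarrow> r \<in> {0<..<1} \<Longrightarrow> k t x r = 0"
    and t: "t \<in> {0..<T}" and r: "r \<in> {0..1}"
  shows "k t x r = 0"
proof (rule zero_at_initial_time[OF cont_slab_t[OF k r] T _ t])
  fix t assume t: "t \<in> {0<..<T}"
  show "k t x r = 0"
    by (rule continuous_constant_on_closure[where S = "{0<..<1}" and f = "k t x"])
      (use cont_slab_r[OF k] z t r in auto)
qed

section \<open>Balance laws extended to the closed tube\<close>

locale smooth_flow =
  fixes T xhat uhat :: real and gp :: "real \<Rightarrow> real \<Rightarrow> real"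
    and u ut ux ur utt utx utr uxt uxx uxr urt urx urr qt qx qr mt mx mr
        V Vt Vx Vr Wt Wx Vrr :: "real \<Rightarrow> real \<Rightarrow> real \<Rightarrow> real"
  assumes T: "0 < T"
    and du: "has_partials T u ut ux ur" and dut: "has_partials T ut utt utx utr"
    and dux: "has_partials T ux uxt uxx uxr" and dur: "has_partials T ur urt urx urr"
    and duxr: "has_partials T uxr qt qx qr" and dqr: "has_partials T qr mt mx mr"
    and dV: "has_partials T V Vt Vx Vr" and dVr: "has_partials T Vr Wt Wx Vrr"
    and momentum_inner: "\<And>t x r. t \<in> {0<..<T} \<Longrightarrow> r \<in> {0<..<1} \<Longrightarrow>
      ut t x r + u t x r * ux t x r + V t x r * ur t x r = gp t x"
    and divfree_inner: "\<And>t x r. t \<in> {0<..<T} \<Longrightarrow> r \<in> {0<..<1} \<Longrightarrow> r * Vr t x r + V t x r = - r * ux t x r"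
    and wall_inner: "\<And>t x. t \<in> {0<..<T} \<Longrightarrow> V t x 1 = 0"
    and V_axis: "\<And>t x. t \<in> {0..<T} \<Longrightarrow> V t x 0 = 0"
    and ur_axis: "\<And>t x. t \<in> {0..<T} \<Longrightarrow> ur t x 0 = 0"
    and init: "\<And>r. r \<in> {0..1} \<Longrightarrow> u 0 xhat r = uhat"
begin

lemmas conts = has_partials_cont[OF du] has_partials_cont[OF dut] has_partials_cont[OF dux]
  has_partials_cont[OF dur] has_partials_cont[OF duxr] has_partials_cont[OF dqr]
  has_partials_cont[OF dV] has_partials_cont[OF dVr]

lemma divfree:
  assumes "t \<in> {0..<T}" "r \<in> {0..1}"
  shows "r * Vr t x r + V t x r = - r * ux t x r"
proof -
  have "cont_slab T (\<lambda>t x r. r * Vr t x r + V t x r + r * ux t x r)"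
    using conts unfolding cont_slab_def case_prod_unfold by (intro continuous_intros)
  from zero_on_slab[OF this T _ assms, of x] show ?thesis using divfree_inner by simp
qed

lemma wall: "t \<in> {0..<T} \<Longrightarrow> V t x 1 = 0"
  using zero_at_initial_time[OF cont_slab_t[OF has_partials_cont(1)[OF dV], of 1 x] T] wall_inner by auto

text \<open>Minus the pressure gradient, read off on the axis, where radial transport vanishes. This
  form inherits the regularity of the velocity and makes sense at time 0.\<close>

definition "pres t x = ut t x 0 + u t x 0 * ux t x 0"

text \<open>Inside the tube the left-hand side equals \<open>gp t x\<close>, so it agrees with its
  value at the sample radius \<open>1/2\<close>; this equality extends by continuity, in particular
  to the axis.\<close>

lemma momentum:
  assumes "t \<in> {0..<T}" "r \<in> {0..1}"
  shows "ut t x r + u t x r * ux t x r + V t x r * ur t x r = pres t x"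
proof -
  define M where "M t x r = ut t x r + u t x r * ux t x r + V t x r * ur t x r" for t x r
  have cM: "cont_slab T M"
    using conts unfolding M_def cont_slab_def case_prod_unfold by (intro continuous_intros)
  have "cont_slab T (\<lambda>t x r. M t x (1/2))"
    unfolding cont_slab_def case_prod_unfold
    by (rule cont_slab_compose[OF cM]) (auto intro!: continuous_intros simp: slab_def)
  then have c: "cont_slab T (\<lambda>t x r. M t x r - M t x (1/2))"
    using cM unfolding cont_slab_def case_prod_unfold by (intro continuous_intros)
  have "M t x r = M t x (1/2)" if "r \<in> {0..1}" for r
    using zero_on_slab[OF c T _ assms(1) that, of x] momentum_inner by (simp add: M_def)
  from this[OF assms(2)] this[of 0] show ?thesis
    using V_axis[OF assms(1)] by (simp add: M_def pres_def)
qed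

text \<open>By incompressibility the integrand is the radial derivative of
  \<open>- (r * V t x r)\<close>, which vanishes at the axis and the wall.\<close>

lemma has_integral_ux:
  assumes "t \<in> {0..<T}"
  shows "((\<lambda>r. r * ux t x r) has_integral 0) {0..1}"
proof -
  have "((\<lambda>r. r * ux t x r) has_integral (- (1 * V t x 1) - (- (0 * V t x 0)))) {0..1}"
  proof (rule fundamental_theorem_of_calculus)
    show "((\<lambda>r. - (r * V t x r)) has_vector_derivative r * ux t x r) (at r within {0..1})"
      if "r \<in> {0..1}" for r
    proof -
      have "((\<lambda>r. - (r * V t x r)) has_real_derivative - (r * Vr t x r + V t x r)) (at r within {0..1})"
        by (auto intro!: derivative_eq_intros has_partials_r[OF dV assms that])
      then show ?thesis
        using divfree[OF assms that, of x] by (simp add: has_real_derivative_iff_has_vector_derivative)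
    qed
  qed auto
  then show ?thesis using wall[OF assms] by simp
qed

section \<open>The mean velocity over a cross-section\<close>

definition "F t = 2 * integral {0..1} (\<lambda>r. r * u t xhat r)"

lemma integrable_r:
  assumes "cont_slab T f" "t \<in> {0..<T}"
  shows "(\<lambda>r. r * f t x r) integrable_on {0..1}"
  by (intro integrable_continuous_real continuous_intros cont_slab_r[OF assms])

text \<open>The derivative of the mean in \<open>x\<close> is an integral of
  \<open>r * ux t x r\<close>, which is 0. The factor 2 normalises the weight \<open>r\<close>,
  whose integral is \<open>1/2\<close>.\<close>

lemma F_eq:
  assumes t: "t \<in> {0..<T}"
  shows "F t = 2 * integral {0..1} (\<lambda>r. r * u t x r)"
proof -
  have "((\<lambda>x. integral (cbox 0 1) (\<lambda>r. r * u t x r)) has_field_derivative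
      integral (cbox 0 1) (\<lambda>r. r * ux t x r)) (at x within UNIV)" for x
  proof (rule leibniz_rule_field_derivative[where f = "\<lambda>x r. r * u t x r" and fx = "\<lambda>x r. r * ux t x r"])
    have "continuous_on (UNIV \<times> cbox 0 (1::real)) (\<lambda>z. ux t (fst z) (snd z))"
      by (rule cont_slab_compose[where T = T]) (use conts t in \<open>auto intro!: continuous_intros simp: slab_def\<close>)
    then show "continuous_on (UNIV \<times> cbox 0 1) (\<lambda>(x, r). r * ux t x r)"
      unfolding case_prod_unfold by (intro continuous_intros)
    show "(\<lambda>r. r * u t x r) integrable_on cbox 0 1" for x
      using integrable_r[OF conts(1) t] by simp
    show "((\<lambda>x. r * u t x r) has_field_derivative r * ux t x r) (at x within UNIV)"
      if "r \<in> cbox 0 1" for x r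
      using that by (auto intro!: DERIV_cmult has_partials_x[OF du t])
  qed auto
  then have "((\<lambda>x. integral {0..1} (\<lambda>r. r * u t x r)) has_real_derivative 0) (at x)" for x
    using integral_unique[OF has_integral_ux[OF t]] by simp
  then have "integral {0..1} (\<lambda>r. r * u t x r) = integral {0..1} (\<lambda>r. r * u t xhat r)"
    using DERIV_isconst_all[of "\<lambda>x. integral {0..1} (\<lambda>r. r * u t x r)"] by blast
  then show ?thesis by (simp add: F_def)
qed

lemma integral_time_derivative:
  assumes f: "\<And>t r. t \<in> {0<..<T} \<Longrightarrow> r \<in> {0..1} \<Longrightarrow> ((\<lambda>t. f t r) has_real_derivative f' t r) (at t)"
    and cf: "continuous_on ({0..<T} \<times> {0..1}) (\<lambda>(t, r). f t r)"
    and cf': "continuous_on ({0..<T} \<times> {0..1}) (\<lambda>(t, r). f' t r)"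
    and t: "t \<in> {0<..<T}"
  shows "((\<lambda>t. integral {0..1} (\<lambda>r. r * f t r)) has_real_derivative
    integral {0..1} (\<lambda>r. r * f' t r)) (at t)"
proof -
  have "((\<lambda>t. integral (cbox 0 1) (\<lambda>r. r * f t r)) has_field_derivative
      integral (cbox 0 1) (\<lambda>r. r * f' t r)) (at t within {0<..<T})"
  proof (rule leibniz_rule_field_derivative[where f = "\<lambda>t r. r * f t r" and fx = "\<lambda>t r. r * f' t r"])
    have "continuous_on ({0<..<T} \<times> cbox 0 1) (\<lambda>(t, r). f' t r)"
      by (rule continuous_on_subset[OF cf']) auto
    then show "continuous_on ({0<..<T} \<times> cbox 0 1) (\<lambda>(t, r). r * f' t r)"
      unfolding case_prod_unfold by (intro continuous_intros)
    show "(\<lambda>r. r * f t r) integrable_on cbox 0 1" if "t \<in> {0<..<T}" for t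
    proof -
      have "continuous_on {0..1} (\<lambda>r. (\<lambda>(t, r). f t r) (t, r))"
        by (rule continuous_on_compose2[OF cf]) (use that in \<open>auto intro!: continuous_intros\<close>)
      then show ?thesis
        by (auto intro!: integrable_continuous_real continuous_intros)
    qed
    show "((\<lambda>t. r * f t r) has_field_derivative r * f' t r) (at t within {0<..<T})"
      if "t \<in> {0<..<T}" "r \<in> cbox 0 1" for t r
      by (intro DERIV_cmult has_field_derivative_at_within[OF f]) (use that in auto)
  qed (use t in auto)
  then show ?thesis by (simp add: at_within_open[OF t])
qed

text \<open>The momentum equation in conservative form: incompressibility turns radial transport
  into the derivative of \<open>r * V t x r * u t x r\<close> plus a second copy of
  \<open>r * u t x r * ux t x r\<close>. The flux through the wall is 0.\<close>

lemma has_integral_momentum: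
  assumes t: "t \<in> {0..<T}"
  shows "((\<lambda>r. r * (ut t x r + 2 * u t x r * ux t x r)) has_integral pres t x / 2) {0..1}"
proof -
  define \<Phi> where "\<Phi> r = r\<^sup>2 / 2 * pres t x - r * V t x r * u t x r" for r
  have "((\<lambda>r. r * (ut t x r + 2 * u t x r * ux t x r)) has_integral \<Phi> 1 - \<Phi> 0) {0..1}"
  proof (rule fundamental_theorem_of_calculus)
    fix r :: real assume r: "r \<in> {0..1}"
    have "(\<Phi> has_real_derivative
        r * pres t x - ((r * Vr t x r + V t x r) * u t x r + r * V t x r * ur t x r)) (at r within {0..1})"
      unfolding \<Phi>_def
      by (auto intro!: derivative_eq_intros has_partials_r[OF dV t r] has_partials_r[OF du t r]
          simp: algebra_simps)
    moreover have "r * pres t x - ((r * Vr t x r + V t x r) * u t x r + r * V t x r * ur t x r)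
        = r * (ut t x r + 2 * u t x r * ux t x r)"
      unfolding divfree[OF t r] momentum[OF t r, symmetric] by (simp add: algebra_simps)
    ultimately show "(\<Phi> has_vector_derivative r * (ut t x r + 2 * u t x r * ux t x r)) (at r within {0..1})"
      by (simp add: has_real_derivative_iff_has_vector_derivative)
  qed auto
  then show ?thesis by (simp add: \<Phi>_def wall[OF t])
qed

lemma F_deriv:
  assumes t: "t \<in> {0<..<T}"
  shows "(F has_real_derivative pres t x - 4 * integral {0..1} (\<lambda>r. r * (u t x r * ux t x r))) (at t)"
proof -
  have t': "t \<in> {0..<T}" using t by auto
  have "((\<lambda>t. integral {0..1} (\<lambda>r. r * u t x r)) has_real_derivative integral {0..1} (\<lambda>r. r * ut t x r)) (at t)"
    by (rule integral_time_derivative[OF has_partials_t[OF du] _ _ t])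
      (intro cont_slab_line conts continuous_intros | assumption)+
  from DERIV_cmult[OF this, of 2]
  have d: "(F has_real_derivative 2 * integral {0..1} (\<lambda>r. r * ut t x r)) (at t)"
    by (rule has_field_derivative_transform_within_open[where S = "{0<..<T}"])
      (use t F_eq[of _ x] in auto)
  have i: "(\<lambda>r. r * (u t x r * ux t x r)) integrable_on {0..1}"
    by (intro integrable_continuous_real continuous_intros cont_slab_r[OF _ t'] conts)
  have i2: "(\<lambda>r. 2 * (r * (u t x r * ux t x r))) integrable_on {0..1}"
    by (intro integrable_continuous_real continuous_intros cont_slab_r[OF _ t'] conts)
  have "integral {0..1} (\<lambda>r. r * ut t x r) + 2 * integral {0..1} (\<lambda>r. r * (u t x r * ux t x r))
      = integral {0..1} (\<lambda>r. r * ut t x r + 2 * (r * (u t x r * ux t x r)))"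
    using integral_add[OF integrable_r[OF conts(2) t'] i2, of x] by simp
  also have "\<dots> = integral {0..1} (\<lambda>r. r * (ut t x r + 2 * u t x r * ux t x r))"
    by (simp add: algebra_simps)
  also have "\<dots> = pres t x / 2" by (rule integral_unique[OF has_integral_momentum[OF t']])
  finally have "2 * integral {0..1} (\<lambda>r. r * ut t x r)
      = pres t x - 4 * integral {0..1} (\<lambda>r. r * (u t x r * ux t x r))" by linarith
  then show ?thesis using d by simp
qed

lemma cont_F: "continuous_on {0..<T} F"
proof -
  have "continuous_on ({0..<T} \<times> cbox 0 1) (\<lambda>(t, r). r * u t xhat r)"
    using cont_slab_line[OF conts(1), of "\<lambda>_. xhat"] unfolding case_prod_unfold
    by (auto intro!: continuous_intros)
  from integral_continuous_on_param[OF this] show ?thesis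
    unfolding F_def by (auto intro!: continuous_intros)
qed

text \<open>Because the mean velocity does not depend on \<open>x\<close>, the path is a plain
  integral and no differential equation has to be solved for it.\<close>

definition "X t = xhat + integral {0..t} F"

lemma X_deriv_within:
  assumes "0 \<le> t" "t < \<tau>" "\<tau> < T"
  shows "(X has_real_derivative F t) (at t within {0..\<tau>})"
proof -
  have "((\<lambda>t. integral {0..t} F) has_real_derivative F t) (at t within {0..\<tau>})"
    by (rule integral_has_real_derivative)
      (use assms in \<open>auto intro: continuous_on_subset[OF cont_F]\<close>)
  then show ?thesis unfolding X_def by (auto intro!: derivative_eq_intros)
qed

lemma X_deriv:
  assumes t: "t \<in> {0<..<T}"
  shows "(X has_real_derivative F t) (at t)"
proof -
  have "(X has_real_derivative F t) (at t within {0..(t + T) / 2})"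
    by (rule X_deriv_within) (use t in auto)
  moreover have "at t within {0..(t + T) / 2} = at t"
    by (rule at_within_interior) (use t in \<open>auto simp: interior_atLeastAtMost_real\<close>)
  ultimately show ?thesis by simp
qed

lemma cont_X: "continuous_on {0..<T} X"
  unfolding continuous_on_eq_continuous_within
proof
  fix t assume t: "t \<in> {0..<T}"
  define \<tau> where "\<tau> = (t + T) / 2"
  have \<tau>: "t < \<tau>" "\<tau> < T" using t by (auto simp: \<tau>_def)
  have "at t within {0..<T} = at t within {0..\<tau>}"
    by (rule at_within_nhd[where S = "{..<\<tau>}"]) (use \<tau> t in auto)
  moreover have "(X has_real_derivative F t) (at t within {0..\<tau>})"
    by (rule X_deriv_within) (use t \<tau> in auto)
  ultimately show "continuous (at t within {0..<T}) X"
    using DERIV_continuous by force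
qed

lemma X_0: "X 0 = xhat" by (simp add: X_def)

lemma F_0: "F 0 = uhat"
proof -
  have "((\<lambda>r. r * uhat) has_integral (1\<^sup>2 / 2 * uhat - 0\<^sup>2 / 2 * uhat)) {0..1::real}"
    by (rule fundamental_theorem_of_calculus)
      (auto intro!: derivative_eq_intros simp: has_real_derivative_iff_has_vector_derivative[symmetric])
  then have "integral {0..1} (\<lambda>r. r * uhat) = uhat / 2" by (simp add: integral_unique)
  moreover have "integral {0..1} (\<lambda>r. r * u 0 xhat r) = integral {0..1} (\<lambda>r. r * uhat)"
    by (rule integral_cong) (use init in auto)
  ultimately show ?thesis by (simp add: F_def)
qed

section \<open>The deviation from the mean on the moving line\<close>

definition "v t r = u t (X t) r - F t"

text \<open>The pressure cancels between the equations for \<open>u\<close> and for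
  \<open>F\<close>. In the nonlocal term \<open>u\<close> may be replaced by \<open>v\<close>, since
  \<open>ux\<close> has mean zero.\<close>

lemma v_deriv:
  assumes t: "t \<in> {0<..<T}" and r: "r \<in> {0..1}"
  shows "((\<lambda>t. v t r) has_real_derivative
    - v t r * ux t (X t) r - V t (X t) r * ur t (X t) r
    + 4 * integral {0..1} (\<lambda>r. r * (v t r * ux t (X t) r))) (at t)"
proof -
  have t': "t \<in> {0..<T}" using t by auto
  have i1: "(\<lambda>r. r * (u t (X t) r * ux t (X t) r)) integrable_on {0..1}"
    by (intro integrable_continuous_real continuous_intros cont_slab_r[OF _ t'] conts)
  have i2: "((\<lambda>r. F t * (r * ux t (X t) r)) has_integral (F t * 0)) {0..1}"
    by (rule has_integral_mult_right[OF has_integral_ux[OF t']])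
  have "((\<lambda>r. r * (u t (X t) r * ux t (X t) r) - F t * (r * ux t (X t) r)) has_integral
      integral {0..1} (\<lambda>r. r * (u t (X t) r * ux t (X t) r)) - F t * 0) {0..1}"
    by (rule has_integral_diff[OF integrable_integral[OF i1] i2])
  then have I: "integral {0..1} (\<lambda>r. r * (v t r * ux t (X t) r))
      = integral {0..1} (\<lambda>r. r * (u t (X t) r * ux t (X t) r))"
    by (intro integral_unique) (simp add: v_def algebra_simps)
  have "((\<lambda>t. v t r) has_real_derivative
      (ut t (X t) r + F t * ux t (X t) r)
      - (pres t (X t) - 4 * integral {0..1} (\<lambda>r. r * (u t (X t) r * ux t (X t) r)))) (at t)"
    unfolding v_def
    by (intro DERIV_diff has_partials_curve[OF du t r X_deriv[OF t]] F_deriv[OF t])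
  moreover have "ut t (X t) r = pres t (X t) - u t (X t) r * ux t (X t) r - V t (X t) r * ur t (X t) r"
    using momentum[OF t' r, of "X t"] by simp
  moreover have "u t (X t) r = v t r + F t" by (simp add: v_def)
  ultimately show ?thesis unfolding I by (simp add: algebra_simps)
qed

lemma cont_line: "cont_slab T f \<Longrightarrow> continuous_on ({0..<T} \<times> {0..1}) (\<lambda>(t, r). f t (X t) r)"
  by (rule cont_slab_line[OF _ cont_X])

lemma cont_v: "continuous_on ({0..<T} \<times> {0..1}) (\<lambda>(t, r). v t r)"
proof -
  have "continuous_on ({0..<T} \<times> {0..1}) (\<lambda>z. F (fst z))"
    by (rule continuous_on_compose2[OF cont_F]) (auto intro!: continuous_intros)
  then show ?thesis
    using cont_line[OF conts(1)] unfolding v_def case_prod_unfold by (intro continuous_intros)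
qed

text \<open>The equation for \<open>v\<close> is homogeneous, so the maximum principle applies to
  its square. At a spatial maximum of the square, the nonlocal integral is controlled by the value
  of \<open>v\<close> at that same point.\<close>

lemma v_zero:
  assumes t: "t \<in> {0..<T}" and r: "r \<in> {0..1}"
  shows "v t r = 0"
proof -
  obtain A where A: "\<And>s r. s \<in> {0..t} \<Longrightarrow> r \<in> {0..1} \<Longrightarrow> \<bar>ux s (X s) r\<bar> \<le> A"
    using bounded_before[OF cont_line[OF has_partials_cont(1)[OF dux]], of t] t by auto
  have "(v t r)\<^sup>2 \<le> 0"
  \<comment> \<open>With \<open>A\<close> bounding \<open>ux\<close> on the line, the local term
    contributes \<open>2 * A\<close> and the nonlocal one \<open>8 * A\<close>.\<close>
  proof (rule max_principle[where h = "\<lambda>t r. (v t r)\<^sup>2" and \<tau> = t and K = "10 * A"])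
    have "continuous_on ({0..t} \<times> {0..1}) (\<lambda>(t, r). v t r)"
      by (rule continuous_on_subset[OF cont_v]) (use t in auto)
    then show "continuous_on ({0..t} \<times> {0..1}) (\<lambda>(t, r). (v t r)\<^sup>2)"
      unfolding case_prod_unfold by (intro continuous_intros)
    show "(v 0 r)\<^sup>2 \<le> 0" if "r \<in> {0..1}" for r
      using init[OF that] by (simp add: v_def X_0 F_0)
  next
    fix s r assume s: "0 < s" "s \<le> t" and r: "r \<in> {0..1}" and pos: "0 < (v s r)\<^sup>2"
      and mx: "\<And>r'. r' \<in> {0..1} \<Longrightarrow> (v s r')\<^sup>2 \<le> (v s r)\<^sup>2"
    have s': "s \<in> {0<..<T}" "s \<in> {0..<T}" "s \<in> {0..t}" using s t by auto
    define J where "J = integral {0..1} (\<lambda>r. r * (v s r * ux s (X s) r))"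
    have J: "\<bar>J\<bar> \<le> A * \<bar>v s r\<bar>"
    proof -
      have "norm J \<le> integral {0..1::real} (\<lambda>_. A * \<bar>v s r\<bar>)"
        unfolding J_def
      proof (rule Henstock_Kurzweil_Integration.integral_norm_bound_integral)
        show "(\<lambda>r. r * (v s r * ux s (X s) r)) integrable_on {0..1}"
          unfolding v_def
          by (intro integrable_continuous_real continuous_intros cont_slab_r[OF _ s'(2)] conts)
        fix y :: real assume y: "y \<in> {0..1}"
        have "\<bar>v s y\<bar> \<le> \<bar>v s r\<bar>" using mx[OF y] by (simp add: abs_le_square_iff)
        moreover have "\<bar>ux s (X s) y\<bar> \<le> A" using A[OF s'(3) y] .
        ultimately have "\<bar>ux s (X s) y\<bar> * \<bar>v s y\<bar> \<le> A * \<bar>v s r\<bar>" by (intro mult_mono) auto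
        moreover have "\<bar>y\<bar> * (\<bar>ux s (X s) y\<bar> * \<bar>v s y\<bar>) \<le> 1 * (\<bar>ux s (X s) y\<bar> * \<bar>v s y\<bar>)"
          using y by (intro mult_right_mono) auto
        ultimately show "norm (y * (v s y * ux s (X s) y)) \<le> A * \<bar>v s r\<bar>"
          by (simp add: abs_mult mult.commute)
      qed auto
      then show ?thesis by simp
    qed
    have "((\<lambda>r. (v s r)\<^sup>2) has_real_derivative 2 * v s r * ur s (X s) r) (at r within {0..1})"
      unfolding v_def by (auto intro!: derivative_eq_intros has_partials_r[OF du s'(2) r])
    then have crit: "V s (X s) r * (2 * v s r * ur s (X s) r) = 0"
      by (rule critical_transport_term) (use r mx V_axis wall s' in auto)
    define D where "D = 2 * v s r * (- v s r * ux s (X s) r - V s (X s) r * ur s (X s) r + 4 * J)"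
    have "((\<lambda>t. (v t r)\<^sup>2) has_real_derivative D) (at s)"
      using v_deriv[OF s'(1) r] by (auto intro!: derivative_eq_intros simp: D_def J_def)
    moreover have "D \<le> 10 * A * (v s r)\<^sup>2"
    proof -
      have "D = - 2 * ux s (X s) r * (v s r)\<^sup>2 + 8 * (v s r * J)"
        using crit by (simp add: D_def algebra_simps power2_eq_square)
      moreover have "- ux s (X s) r * (v s r)\<^sup>2 \<le> A * (v s r)\<^sup>2"
        using A[OF s'(3) r] by (intro mult_right_mono) auto
      moreover have "v s r * J \<le> \<bar>v s r\<bar> * \<bar>J\<bar>" by (metis abs_ge_self abs_mult)
      moreover have "\<bar>v s r\<bar> * \<bar>J\<bar> \<le> \<bar>v s r\<bar> * (A * \<bar>v s r\<bar>)" using J by (intro mult_left_mono) auto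
      moreover have "\<bar>v s r\<bar> * (A * \<bar>v s r\<bar>) = A * (v s r)\<^sup>2"
        by (simp add: power2_eq_square)
      ultimately show ?thesis by simp
    qed
    ultimately show "\<exists>D. ((\<lambda>t. (v t r)\<^sup>2) has_real_derivative D) (at s) \<and> D \<le> 10 * A * (v s r)\<^sup>2"
      by blast
  qed (use t r in auto)
  then show ?thesis by simp
qed

lemma u_line: "t \<in> {0..<T} \<Longrightarrow> r \<in> {0..1} \<Longrightarrow> u t (X t) r = F t"
  using v_zero by (simp add: v_def)

lemma unique_r:
  fixes f :: "real \<Rightarrow> real"
  assumes "(f has_real_derivative d) (at r within {0..1})" "(f has_real_derivative d') (at r within {0..1})"
    "r \<in> {0..1}"
  shows "d = d'"
  using vector_derivative_unique_within_closed_interval[of 0 1 r f] assms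
  by (simp add: has_real_derivative_iff_has_vector_derivative)

lemma ur_line:
  assumes "t \<in> {0..<T}" "r \<in> {0..1}"
  shows "ur t (X t) r = 0"
proof (rule unique_r[OF has_partials_r[OF du assms]])
  show "(u t (X t) has_real_derivative 0) (at r within {0..1})"
    by (rule has_field_derivative_transform[OF assms(2), where f = "\<lambda>_. F t"])
      (use u_line assms in auto)
qed (use assms in auto)

text \<open>Here \<open>x\<close> plays the role of time in \<open>interchange_derivatives\<close>;
  the radius 1 of the window is arbitrary.\<close>

lemma ur_x:
  assumes t: "t \<in> {0..<T}" and r: "r \<in> {0..1}"
  shows "((\<lambda>x. ur t x r) has_real_derivative uxr t x r) (at x)"
proof (rule interchange_derivatives[where f = "u t" and G = "ux t" and q = "ur t" and Gr = "uxr t"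
      and a = "x - 1" and b = "x + 1" and c = 0 and d = 1])
  show "continuous_on ({x - 1<..<x + 1} \<times> {0..1}) (\<lambda>(x, r). uxr t x r)"
    unfolding case_prod_unfold
    by (rule cont_slab_compose[OF has_partials_cont(1)[OF duxr]])
      (use t in \<open>auto intro!: continuous_intros simp: slab_def\<close>)
qed (use has_partials_x[OF du t] has_partials_r[OF du t] has_partials_r[OF dux t] r in auto)

lemma urr_x:
  assumes t: "t \<in> {0..<T}" and r: "r \<in> {0..1}"
  shows "((\<lambda>x. urr t x r) has_real_derivative qr t x r) (at x)"
proof (rule interchange_derivatives[where f = "ur t" and G = "uxr t" and q = "urr t" and Gr = "qr t"
      and a = "x - 1" and b = "x + 1" and c = 0 and d = 1])
  show "continuous_on ({x - 1<..<x + 1} \<times> {0..1}) (\<lambda>(x, r). qr t x r)"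
    unfolding case_prod_unfold
    by (rule cont_slab_compose[OF has_partials_cont(1)[OF dqr]])
      (use t in \<open>auto intro!: continuous_intros simp: slab_def\<close>)
qed (use ur_x[OF t] has_partials_r[OF dur t] has_partials_r[OF duxr t] r in auto)

lemma uxt_eq:
  assumes t: "t \<in> {0<..<T}" and r: "r \<in> {0..1}"
  shows "uxt t x r = utx t x r"
proof -
  have "((\<lambda>t. ux t x r) has_real_derivative utx t x r) (at t)"
  proof (rule interchange_derivatives[where f = "\<lambda>t x. u t x r" and G = "\<lambda>t x. ut t x r"
        and q = "\<lambda>t x. ux t x r" and Gr = "\<lambda>t x. utx t x r" and a = 0 and b = T and c = x and d = "x + 1"])
    show "continuous_on ({0<..<T} \<times> {x..x + 1}) (\<lambda>(t, x). utx t x r)"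
      unfolding case_prod_unfold
      by (rule cont_slab_compose[OF has_partials_cont(3)[OF dut]])
        (use r in \<open>auto intro!: continuous_intros simp: slab_def\<close>)
  qed (use has_partials_x[OF du] has_partials_x[OF dut] has_partials_t[OF du] t r in auto)
  then show ?thesis using DERIV_unique has_partials_t[OF dux t r] by blast
qed

section \<open>The equation for the axial derivative on the moving line\<close>

definition "P t = utx t (X t) 0 + (ux t (X t) 0)\<^sup>2 + F t * uxx t (X t) 0"

text \<open>The momentum equation is differentiated in \<open>x\<close> at \<open>X t\<close>. There
  \<open>u\<close> equals \<open>F t\<close> and \<open>ur\<close> vanishes, which removes the term
  with \<open>Vx\<close> and closes the equation. The result does not depend on \<open>r\<close>, so
  it equals its value on the axis.\<close>

lemma momentum_x:
  assumes t: "t \<in> {0..<T}" and r: "r \<in> {0..1}"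
  shows "utx t (X t) r + (ux t (X t) r)\<^sup>2 + F t * uxx t (X t) r + V t (X t) r * uxr t (X t) r = P t"
proof -
  have r0: "0 \<in> {0..1::real}" by simp
  have *: "((\<lambda>x. ut t x r + u t x r * ux t x r + V t x r * ur t x r) has_real_derivative
      utx t (X t) r + (ux t (X t) r)\<^sup>2 + F t * uxx t (X t) r + V t (X t) r * uxr t (X t) r) (at (X t))"
    if r: "r \<in> {0..1}" for r
    using u_line[OF t r] ur_line[OF t r]
    by (auto intro!: derivative_eq_intros has_partials_x[OF dut t r] has_partials_x[OF du t r]
        has_partials_x[OF dux t r] has_partials_x[OF dV t r] ur_x[OF t r] simp: power2_eq_square)
  have "((\<lambda>x. pres t x) has_real_derivative
      utx t (X t) r + (ux t (X t) r)\<^sup>2 + F t * uxx t (X t) r + V t (X t) r * uxr t (X t) r) (at (X t))"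
    using *[OF r] unfolding momentum[OF t r] .
  moreover have "((\<lambda>x. pres t x) has_real_derivative P t) (at (X t))"
    using *[OF r0] unfolding momentum[OF t r0] by (simp add: P_def V_axis[OF t])
  ultimately show ?thesis by (rule DERIV_unique)
qed

lemma a_deriv:
  assumes t: "t \<in> {0<..<T}" and r: "r \<in> {0..1}"
  shows "((\<lambda>t. ux t (X t) r) has_real_derivative
    P t - (ux t (X t) r)\<^sup>2 - V t (X t) r * uxr t (X t) r) (at t)"
  using has_partials_curve[OF dux t r X_deriv[OF t]] momentum_x[of t r] uxt_eq[OF t r, of "X t"] t r
  by (auto elim!: DERIV_cong)

text \<open>The mean of \<open>ux\<close> on the line is 0 at all times, hence so is the mean of its
  time derivative. Integrating the equation and moving the radial derivative onto
  \<open>r * V\<close> yields a second copy of the quadratic term, which accounts for the factor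
  4.\<close>

lemma P_eq:
  assumes t: "t \<in> {0<..<T}"
  shows "P t = 4 * integral {0..1} (\<lambda>r. r * (ux t (X t) r)\<^sup>2)"
proof -
  have t': "t \<in> {0..<T}" using t by auto
  define a' where "a' t r = uxt t (X t) r + F t * uxx t (X t) r" for t r
  have cF: "continuous_on ({0..<T} \<times> {0..1::real}) (\<lambda>z. F (fst z))"
    by (rule continuous_on_compose2[OF cont_F]) (auto intro!: continuous_intros)
  have "((\<lambda>t. integral {0..1} (\<lambda>r. r * ux t (X t) r)) has_real_derivative
      integral {0..1} (\<lambda>r. r * a' t r)) (at t)"
  proof (rule integral_time_derivative[OF _ _ _ t])
    show "((\<lambda>t. ux t (X t) r) has_real_derivative a' t r) (at t)" if "t \<in> {0<..<T}" "r \<in> {0..1}" for t r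
      unfolding a'_def by (rule has_partials_curve[OF dux that X_deriv[OF that(1)]])
    show "continuous_on ({0..<T} \<times> {0..1}) (\<lambda>(t, r). a' t r)"
      using cont_line[OF has_partials_cont(2)[OF dux]] cont_line[OF has_partials_cont(3)[OF dux]] cF
      unfolding a'_def case_prod_unfold by (intro continuous_intros)
  qed (rule cont_line[OF has_partials_cont(1)[OF dux]])
  moreover have "((\<lambda>t. integral {0..1} (\<lambda>r. r * ux t (X t) r)) has_real_derivative 0) (at t)"
  proof (rule has_field_derivative_transform_within_open[where f = "\<lambda>_. 0" and S = "{0<..<T}"])
    show "0 = integral {0..1} (\<lambda>r. r * ux s (X s) r)" if "s \<in> {0<..<T}" for s
      using integral_unique[OF has_integral_ux[of s "X s"]] that by auto
  qed (use t in auto)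
  ultimately have zero: "integral {0..1} (\<lambda>r. r * a' t r) = 0" by (rule DERIV_unique)
  define \<Phi> where "\<Phi> r = r\<^sup>2 / 2 * P t - r * V t (X t) r * ux t (X t) r" for r
  have I: "((\<lambda>r. r * a' t r + 2 * (r * (ux t (X t) r)\<^sup>2)) has_integral \<Phi> 1 - \<Phi> 0) {0..1}"
  proof (rule fundamental_theorem_of_calculus)
    fix r :: real assume r: "r \<in> {0..1}"
    have "(\<Phi> has_real_derivative
        r * P t - ((r * Vr t (X t) r + V t (X t) r) * ux t (X t) r + r * V t (X t) r * uxr t (X t) r))
        (at r within {0..1})"
      unfolding \<Phi>_def
      by (auto intro!: derivative_eq_intros has_partials_r[OF dV t' r] has_partials_r[OF dux t' r]
          simp: algebra_simps)
    moreover have "r * P t - ((r * Vr t (X t) r + V t (X t) r) * ux t (X t) r + r * V t (X t) r * uxr t (X t) r)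
        = r * a' t r + 2 * (r * (ux t (X t) r)\<^sup>2)"
      unfolding divfree[OF t' r] momentum_x[OF t' r, symmetric] a'_def uxt_eq[OF t r]
      by (simp add: algebra_simps power2_eq_square)
    ultimately show "(\<Phi> has_vector_derivative r * a' t r + 2 * (r * (ux t (X t) r)\<^sup>2)) (at r within {0..1})"
      by (simp add: has_real_derivative_iff_has_vector_derivative)
  qed auto
  have i1: "(\<lambda>r. r * a' t r) integrable_on {0..1}"
    unfolding a'_def
    by (intro integrable_continuous_real continuous_intros cont_slab_r[OF _ t'] conts)
  have i2: "(\<lambda>r. 2 * (r * (ux t (X t) r)\<^sup>2)) integrable_on {0..1}"
    by (intro integrable_continuous_real continuous_intros cont_slab_r[OF _ t'] conts)
  have "\<Phi> 1 - \<Phi> 0 = 2 * integral {0..1} (\<lambda>r. r * (ux t (X t) r)\<^sup>2)"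
    using integral_unique[OF I] integral_add[OF i1 i2] zero by simp
  then show ?thesis by (simp add: \<Phi>_def wall[OF t'])
qed

lemma line_flow:
  "line_flow T (\<lambda>t. ux t (X t)) (\<lambda>t. uxr t (X t)) (\<lambda>t. qr t (X t)) (\<lambda>t. mr t (X t))
     (\<lambda>t. V t (X t)) (\<lambda>t. Vr t (X t)) (\<lambda>t. Vrr t (X t)) P"
proof
  show "uxr t (X t) 0 = 0" if t: "t \<in> {0..<T}" for t
  proof -
    have "((\<lambda>x. ur t x 0) has_real_derivative 0) (at (X t))"
      using ur_axis[OF t] by simp
    then show ?thesis using ur_x[OF t, of 0 "X t"] DERIV_unique by fastforce
  qed
qed (use T conts a_deriv P_eq divfree wall V_axis in
      \<open>auto intro!: cont_line has_partials_r[OF dux] has_partials_r[OF duxr] has_partials_r[OF dqr]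
        has_partials_r[OF dV] has_partials_r[OF dVr]\<close>)

end

section \<open>The datum and the bound on the lifespan\<close>

context smooth_flow
begin

context
  fixes u0 :: "real \<Rightarrow> real \<Rightarrow> real"
  assumes u0: "\<And>x r. r \<in> {0..1} \<Longrightarrow> u0 x r = u 0 x r"
begin

lemma T0: "0 \<in> {0..<T}" using T by simp

lemma u0_r: "r \<in> {0..1} \<Longrightarrow> vector_derivative (u0 x) (at r within {0..1}) = ur 0 x r"
proof -
  assume r: "r \<in> {0..1}"
  have "(u0 x has_real_derivative ur 0 x r) (at r within {0..1})"
    by (rule has_field_derivative_transform[OF r u0 has_partials_r[OF du T0 r]])
  then show ?thesis
    using r by (intro vector_derivative_within_closed_interval)
      (auto simp: has_real_derivative_iff_has_vector_derivative)
qed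

lemma Lr_u0: "0 < r \<Longrightarrow> r \<le> 1 \<Longrightarrow> Lr u0 x r = ur 0 x r / r"
  by (simp add: Lr_def u0_r)

text \<open>Since \<open>ur\<close> vanishes on the axis, the quotient \<open>ur 0 x r / r\<close>
  is a difference quotient of \<open>ur\<close> there.\<close>

lemma Lr_u0_axis: "Lr u0 x 0 = urr 0 x 0"
proof -
  have "(ur 0 x has_real_derivative urr 0 x 0) (at 0 within {0..1})"
    using has_partials_r[OF dur T0, of 0] by simp
  then have "((\<lambda>r. (ur 0 x r - ur 0 x 0) / (r - 0)) \<longlongrightarrow> urr 0 x 0) (at 0 within {0..1})"
    by (simp add: has_field_derivative_iff)
  then have "((\<lambda>r. ur 0 x r / r) \<longlongrightarrow> urr 0 x 0) (at_right 0)"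
    using ur_axis[OF T0] at_within_Icc_at_right[of 0 "1::real"] by simp
  moreover have "\<forall>\<^sub>F r in at_right 0. ur 0 x r / r = 1 / r * vector_derivative (u0 x) (at r within {0..1})"
    unfolding eventually_at_right_field by (intro exI[of _ 1]) (auto simp: u0_r)
  ultimately have "((\<lambda>r. 1 / r * vector_derivative (u0 x) (at r within {0..1})) \<longlongrightarrow> urr 0 x 0) (at_right 0)"
    by (rule Lim_transform_eventually)
  then show ?thesis by (simp add: Lr_def tendsto_Lim)
qed

lemma Lr_Lr_u0:
  assumes "0 < r" "r < 1"
  shows "Lr (Lr u0) x r = (r * urr 0 x r - ur 0 x r) / r ^ 3"
proof -
  have r: "r \<in> {0..1}" using assms by auto
  have at: "at r within {0..1} = at r"
    by (rule at_within_interior) (use assms in \<open>auto simp: interior_atLeastAtMost_real\<close>)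
  have "((\<lambda>r. ur 0 x r / r) has_real_derivative (r * urr 0 x r - ur 0 x r) / r\<^sup>2) (at r)"
    using has_partials_r[OF dur T0 r, of x] assms unfolding at
    by (auto intro!: derivative_eq_intros simp: power2_eq_square algebra_simps)
  then have "(Lr u0 x has_real_derivative (r * urr 0 x r - ur 0 x r) / r\<^sup>2) (at r)"
    by (rule has_field_derivative_transform_within_open[where S = "{0<..<1}"])
      (use assms Lr_u0 in auto)
  then have "vector_derivative (Lr u0 x) (at r within {0..1}) = (r * urr 0 x r - ur 0 x r) / r\<^sup>2"
    unfolding at by (simp add: has_real_derivative_iff_has_vector_derivative vector_derivative_at)
  then show ?thesis using assms by (simp add: Lr_def power2_eq_square power3_eq_cube)
qed

lemma dx_u0: "r \<in> {0..1} \<Longrightarrow> dx u0 x r = ux 0 x r"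
  unfolding dx_def using u0 has_partials_x[OF du T0] by (auto intro!: DERIV_imp_deriv)

lemma dx_Lr_u0_axis: "dx (Lr u0) x 0 = qr 0 x 0"
  unfolding dx_def Lr_u0_axis using urr_x[OF T0, of 0] by (intro DERIV_imp_deriv) auto

lemma dx_Lr_u0_wall: "dx (Lr u0) x 1 = uxr 0 x 1"
  unfolding dx_def using ur_x[OF T0, of 1] by (auto intro!: DERIV_imp_deriv simp: Lr_u0)

lemma dx_Lr_Lr_u0:
  assumes "0 < r" "r < 1"
  shows "dx (Lr (Lr u0)) x r = (r * qr 0 x r - uxr 0 x r) / r ^ 3"
proof -
  have "((\<lambda>x. (r * urr 0 x r - ur 0 x r) / r ^ 3) has_real_derivative (r * qr 0 x r - uxr 0 x r) / r ^ 3) (at x)"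
    using assms by (intro DERIV_cdivide) (auto intro!: derivative_eq_intros ur_x[OF T0] urr_x[OF T0])
  then show ?thesis
    unfolding dx_def using Lr_Lr_u0[OF assms] by (auto intro!: DERIV_imp_deriv)
qed

text \<open>Translates the datum conditions: \<open>Lr\<close> on the axis becomes
  \<open>m 0 0 = 0\<close>, on the wall \<open>q 0 1 = 0\<close>, and the sign condition is divided
  by a positive \<open>r ^ 3\<close>. The condition at one end bounds the lifespan through the value
  at the other end, which is negative; hence the absolute value.\<close>

lemma lifespan:
  assumes "dx (Lr u0) xhat 0 = 0 \<or> dx (Lr u0) xhat 1 = 0"
    and "\<forall>r\<in>{0<..<1}. dx (Lr (Lr u0)) xhat r < 0"
  shows "\<exists>r\<in>{0, 1}. T \<le> 3 / \<bar>dx u0 xhat r\<bar>"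
proof -
  interpret line_flow T "\<lambda>t. ux t (X t)" "\<lambda>t. uxr t (X t)" "\<lambda>t. qr t (X t)" "\<lambda>t. mr t (X t)"
    "\<lambda>t. V t (X t)" "\<lambda>t. Vr t (X t)" "\<lambda>t. Vrr t (X t)" P
    by (rule line_flow)
  have g: "r * qr 0 (X 0) r - uxr 0 (X 0) r < 0" if r: "r \<in> {0<..<1}" for r
  proof -
    have "(r * qr 0 xhat r - uxr 0 xhat r) / r ^ 3 < 0"
      using assms(2) r dx_Lr_Lr_u0[of r xhat] by (metis greaterThanLessThan_iff)
    then show ?thesis using r by (simp add: X_0 divide_less_0_iff)
  qed
  from assms(1) show ?thesis
  proof
    assume "dx (Lr u0) xhat 0 = 0"
    then have "qr 0 (X 0) 0 = 0" by (simp add: dx_Lr_u0_axis X_0)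
    from lifespan_axis[OF g this] have "T \<le> 3 / \<bar>dx u0 xhat 1\<bar>" by (simp add: X_0 dx_u0)
    then show ?thesis by blast
  next
    assume "dx (Lr u0) xhat 1 = 0"
    then have "uxr 0 (X 0) 1 = 0" by (simp add: dx_Lr_u0_wall X_0)
    from lifespan_wall[OF g this] have "T \<le> 3 / \<bar>dx u0 xhat 0\<bar>" by (simp add: X_0 dx_u0)
    then show ?thesis by blast
  qed
qed

end

end

section \<open>From the Cartesian field to functions of \<open>t\<close>, \<open>x\<close> and
  \<open>r\<close>\<close>

lemma bounded_linear_meridian: "bounded_linear (\<lambda>(t::real, x::real, r::real). (t, x, r, 0::real))"
  unfolding case_prod_unfold
  by (intro bounded_linear_Pair bounded_linear_fst bounded_linear_zero
      bounded_linear_compose[OF bounded_linear_fst] bounded_linear_compose[OF bounded_linear_snd]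
      bounded_linear_snd)

text \<open>Along a diameter the axial velocity is the even reflection of its radial profile.
  Smoothness across the axis makes it differentiable at 0, and an even function has derivative 0
  there.\<close>

lemma axisym_radial_derivative_zero:
  assumes sm: "smooth_axisym_field T U R" and t: "t \<in> {0..<T}"
    and d: "(U t x has_real_derivative d) (at 0 within {0..1})"
  shows "d = 0"
proof -
  define D where "D = {(t, x::real, y, z). 0 \<le> t \<and> t < T \<and> y\<^sup>2 + z\<^sup>2 \<le> (1::real)}"
  have "Ck_on (Suc 0) D (axisym_field U R)"
    using sm by (simp only: smooth_axisym_field_def smooth_on_def D_def)
  then obtain f' where f': "\<And>a. a \<in> D \<Longrightarrow> (axisym_field U R has_derivative f' a) (at a within D)" by auto
  have sq: "y\<^sup>2 \<le> 1" if "y \<in> {-1<..<1}" for y :: real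
    using that by (simp add: abs_square_le_1 abs_le_iff)
  have "((\<lambda>y. axisym_field U R (t, x, y, 0)) has_derivative (\<lambda>h. f' (t, x, 0, 0) (0, 0, h, 0)))
      (at 0 within {-1<..<1})"
    by (rule has_derivative_in_compose2[OF f', where f = "\<lambda>y. (t, x, y, 0)"])
      (use t sq in \<open>auto simp: D_def intro!: derivative_eq_intros\<close>)
  then have "((\<lambda>y. fst (axisym_field U R (t, x, y, 0))) has_derivative (\<lambda>h. fst (f' (t, x, 0, 0) (0, 0, h, 0))))
      (at 0 within {-1<..<1})"
    by (rule has_derivative_fst)
  then have "(\<lambda>y. fst (axisym_field U R (t, x, y, 0))) differentiable (at 0)"
    unfolding differentiable_def by (auto simp: at_within_open[of 0 "{-1<..<1}"])
  then obtain c where c: "((\<lambda>y. U t x \<bar>y\<bar>) has_real_derivative c) (at 0)"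
    by (auto simp: axisym_field_def real_differentiable_def Let_def)
  have "((\<lambda>y. U t x \<bar>- y\<bar>) has_real_derivative c * - 1) (at 0)"
    by (rule DERIV_chain2[where f = "\<lambda>y. U t x \<bar>y\<bar>" and g = uminus])
      (use c in \<open>auto intro!: derivative_eq_intros\<close>)
  then have c0: "c = 0" using DERIV_unique[OF c, of "- c"] by simp
  have "(U t x has_real_derivative c) (at 0 within {0..1})"
    by (rule has_field_derivative_transform[OF _ _ has_field_derivative_at_within[OF c]]) auto
  with d show ?thesis
    using vector_derivative_unique_within_closed_interval[of 0 1 0 "U t x"] c0
    by (simp add: has_real_derivative_iff_has_vector_derivative)
qed

lemma smooth_AHEE_solution_lifespan:
  assumes T: "0 < T" and sol: "smooth_AHEE_solution T u0 U R p"
    and init: "\<forall>r\<in>{0..1}. u0 xhat r = uhat"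
    and bdry: "dx (Lr u0) xhat 0 = 0 \<or> dx (Lr u0) xhat 1 = 0"
    and conc: "\<forall>r\<in>{0<..<1}. dx (Lr (Lr u0)) xhat r < 0"
  shows "\<exists>r\<in>{0, 1}. T \<le> 3 / \<bar>dx u0 xhat r\<bar>"
proof -
  have sm: "smooth_axisym_field T U R" and eq: "AHEE T u0 U R p"
    using sol by (auto simp: smooth_AHEE_solution_def)
  define D where "D = {(t, x::real, y, z). 0 \<le> t \<and> t < T \<and> y\<^sup>2 + z\<^sup>2 \<le> (1::real)}"
  have Ck: "Ck_on k D (axisym_field U R)" for k
    using sm by (simp only: smooth_axisym_field_def smooth_on_def D_def)
  have sub: "(\<lambda>(t, x, r). (t, x, r, 0)) ` slab T \<subseteq> D"
    by (auto simp: slab_def D_def abs_square_le_1)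
  \<comment> \<open>The field does not see the value of \<open>R\<close> at \<open>r = 0\<close>,
    because \<open>y / r\<close> is 0 there by convention; \<open>V\<close> is the radial component
    that the field really has.\<close>
  define V where "V t x r = (if r = 0 then 0 else R t x r)" for t x r
  note Ckm = Ck_on_compose_linear[OF bounded_linear_meridian sub Ck]
  have CU: "Ck_on k (slab T) (\<lambda>(t, x, r). U t x r)" for k
    by (rule Ck_on_cong[OF Ck_on_linear_image[OF bounded_linear_fst Ckm]])
      (auto simp: slab_def axisym_field_def)
  have CV: "Ck_on k (slab T) (\<lambda>(t, x, r). V t x r)" for k
    by (rule Ck_on_cong[OF Ck_on_linear_image[OF bounded_linear_compose[OF bounded_linear_fst bounded_linear_snd] Ckm]])
      (auto simp: slab_def axisym_field_def V_def)
  \<comment> \<open>Four derivatives of \<open>U\<close> are needed, one in \<open>x\<close> and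
    three in \<open>r\<close>, and two of \<open>V\<close>.\<close>
  obtain Ut Ux Ur where U: "has_partials T U Ut Ux Ur"
    "Ck_on (Suc (Suc (Suc 0))) (slab T) (\<lambda>(t, x, r). Ut t x r)"
    "Ck_on (Suc (Suc (Suc 0))) (slab T) (\<lambda>(t, x, r). Ux t x r)"
    "Ck_on (Suc (Suc (Suc 0))) (slab T) (\<lambda>(t, x, r). Ur t x r)"
    using Ck_on_partials[OF CU] by blast
  obtain Utt Utx Utr where Ut: "has_partials T Ut Utt Utx Utr"
    using Ck_on_partials[OF U(2)] by blast
  obtain Uxt Uxx Uxr where Ux: "has_partials T Ux Uxt Uxx Uxr"
    "Ck_on (Suc (Suc 0)) (slab T) (\<lambda>(t, x, r). Uxr t x r)"
    using Ck_on_partials[OF U(3)] by blast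
  obtain Urt Urx Urr where Ur: "has_partials T Ur Urt Urx Urr"
    using Ck_on_partials[OF U(4)] by blast
  obtain Qt Qx Qr where Uxr: "has_partials T Uxr Qt Qx Qr"
    "Ck_on (Suc 0) (slab T) (\<lambda>(t, x, r). Qr t x r)"
    using Ck_on_partials[OF Ux(2)] by blast
  obtain Mt Mx Mr where Qr: "has_partials T Qr Mt Mx Mr"
    using Ck_on_partials[OF Uxr(2)] by blast
  obtain Vt Vx Vr where V: "has_partials T V Vt Vx Vr" "Ck_on (Suc 0) (slab T) (\<lambda>(t, x, r). Vr t x r)"
    using Ck_on_partials[OF CV] by blast
  obtain Wt Wx Vrr where Vr: "has_partials T Vr Wt Wx Vrr"
    using Ck_on_partials[OF V(2)] by blast
  interpret smooth_flow T xhat uhat "\<lambda>t x. - deriv (p t) x" U Ut Ux Ur Utt Utx Utr Uxt Uxx Uxr Urt Urx Urr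
    Qt Qx Qr Mt Mx Mr V Vt Vx Vr Wt Wx Vrr
  proof
    fix t x r :: real assume t: "t \<in> {0<..<T}" and r: "r \<in> {0<..<1}"
    have t': "t \<in> {0..<T}" and r': "r \<in> {0..1}" using t r by auto
    have at: "at r within {0..1} = at r"
      by (rule at_within_interior) (use r in \<open>auto simp: interior_atLeastAtMost_real\<close>)
    have Dt: "deriv (\<lambda>s. U s x r) t = Ut t x r"
      by (rule DERIV_imp_deriv[OF has_partials_t[OF U(1) t r']])
    have Dx: "deriv (\<lambda>y. U t y r) x = Ux t x r"
      by (rule DERIV_imp_deriv[OF has_partials_x[OF U(1) t' r']])
    have Dr: "deriv (\<lambda>s. U t x s) r = Ur t x r"
      using has_partials_r[OF U(1) t' r', of x] unfolding at by (rule DERIV_imp_deriv)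
    have "((\<lambda>s. s * V t x s) has_real_derivative r * Vr t x r + V t x r) (at r)"
      using has_partials_r[OF V(1) t' r', of x] unfolding at by (auto intro!: derivative_eq_intros)
    then have "((\<lambda>s. s * R t x s) has_real_derivative r * Vr t x r + V t x r) (at r)"
      by (rule has_field_derivative_transform_within_open[where S = "{0<..<1}"])
        (use r in \<open>auto simp: V_def\<close>)
    then have DV: "deriv (\<lambda>s. s * R t x s) r = r * Vr t x r + V t x r" by (rule DERIV_imp_deriv)
    have "deriv (\<lambda>s. U s x r) t + U t x r * deriv (\<lambda>y. U t y r) x + R t x r * deriv (\<lambda>s. U t x s) r
        = - deriv (p t) x"
      using eq t r unfolding AHEE_def by blast
    then show "Ut t x r + U t x r * Ux t x r + V t x r * Ur t x r = - deriv (p t) x"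
      using r by (simp add: Dt Dx Dr V_def)
    have "deriv (\<lambda>y. U t y r) x + 1 / r * deriv (\<lambda>s. s * R t x s) r = 0"
      using eq t r unfolding AHEE_def by blast
    then show "r * Vr t x r + V t x r = - r * Ux t x r"
      using r by (simp add: Dx DV field_simps)
  next
    fix t x :: real assume t: "t \<in> {0..<T}"
    show "Ur t x 0 = 0"
      by (rule axisym_radial_derivative_zero[OF sm t has_partials_r[OF U(1) t]]) simp
  qed (use T U(1) Ut Ux(1) Ur Uxr(1) Qr V(1) Vr eq init in \<open>auto simp: V_def AHEE_def\<close>)
  show ?thesis
    by (rule lifespan[OF _ bdry conc]) (use eq in \<open>auto simp: AHEE_def\<close>)
qed

theorem theorem2p6:
  fixes u0 :: "real \<Rightarrow> real \<Rightarrow> real" and xhat uhat :: real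
  assumes "smooth_axisym_datum u0"
    and "\<forall>r\<in>{0..1}. u0 xhat r = uhat"
    and "dx (Lr u0) xhat 0 = 0 \<or> dx (Lr u0) xhat 1 = 0"
    and "\<forall>r\<in>{0<..<1}. dx (Lr (Lr u0)) xhat r < 0"
  shows "\<exists>T>0. \<forall>ux ur p. smooth_AHEE_solution T u0 ux ur p \<longrightarrow>
    ((\<lambda>t. Max {Linf_norm tube (\<lambda>(x, r). ux t x r),
               Linf_norm tube (\<lambda>(x, r). dx (ux t) x r),
               Linf_norm UNIV (deriv (p t))}) \<longlongrightarrow> \<infinity>) (at_left T)"
proof -
  \<comment> \<open>The lifespan bound holds at one of the two endpoints, so both are added, and the
    summand 1 makes \<open>T\<close> exceed either. A zero denominator gives the harmless value
    0.\<close>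
  define T where "T = 1 + 3 / \<bar>dx u0 xhat 0\<bar> + 3 / \<bar>dx u0 xhat 1\<bar>"
  have ge: "3 / \<bar>dx u0 xhat 0\<bar> \<ge> 0" "3 / \<bar>dx u0 xhat 1\<bar> \<ge> 0" by simp_all
  then have T: "0 < T" by (simp add: T_def add_pos_nonneg)
  have "\<not> smooth_AHEE_solution T u0 ux ur p" for ux ur p
    using smooth_AHEE_solution_lifespan[OF T _ assms(2-4), of ux ur p] ge by (auto simp: T_def)
  then show ?thesis using T by blast
qed

end
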